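(* Suppose that $b>0$ and that there is a constant $\theta>0$ such that $\phi(z)>0$ for all $z>\theta$ and $\int_\theta^\infty\phi(z)^{-1}dz<\infty$. Let $\{Y_t:t\in\mathbb{R}\}$ be the stationary Markov process whose finite-dimensional distributions are, for $t_1<t_2<\cdots<t_n$ in $\mathbb{R}$, $$\mu(dx_1)P_{t_2-t_1}(x_1,dx_2)\cdots P_{t_n-t_{n-1}}(x_{n-1},dx_n).$$ Then $\{Y_t\}$ is strongly mixing with geometric rate, that is, $$\pi_t:=\sup_{A\in\sigma\{Y_s,\,s\le 0\}}\ \sup_{B\in\sigma\{Y_s,\,s>t\}}\big|\mathbf{P}(A\cap B)-\mathbf{P}(A)\mathbf{P}(B)\big|$$ decays to zero exponentially as $t\to\infty$ (i.e. there are constants $C,c>0$ with $\pi_t\le Ce^{-ct}$ for all $t\ge 0$).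
   Context: Let $\sigma\ge 0$ and $b\in\mathbb{R}$ be constants, $a\ge0$, $m$ a measure on $(0,\infty)$ such that $(u\wedge u^2)m(du)$ is a finite measure, and $$\phi(z)=bz+\tfrac12\sigma^2z^2+\int_0^\infty (e^{-zu}-1+zu)\,m(du),\qquad z\ge 0.$$ For $\lambda\ge 0$ let $t\mapsto v_t(\lambda)$ be the unique positive (nonnegative) solution of $\frac{\partial}{\partial t}v_t(\lambda)=-\phi(v_t(\lambda))$, $v_0(\lambda)=\lambda$. The CBI-process with branching mechanism $\phi$ and immigration rate $a$ is the Markov process on $\mathbb{R}_+=[0,\infty)$ with transition semigroup $(P_t)_{t\ge0}$ given by $$\int_0^\infty e^{-\lambda y}P_t(x,dy)=\exp\Big\{-xv_t(\lambda)-a\int_0^t v_s(\lambda)ds\Big\},\qquad \lambda\ge0.$$ When $b>0$ it has a unique stationary distribution $\mu$, with Laplace transform $\int_0^\infty e^{-\lambda x}\mu(dx)=\exp\{-a\int_0^\lambda z\phi(z)^{-1}dz\}$, $\lambda\ge0$. *)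

theory Defs
  imports "HOL-Probability.Probability"
begin

text \<open>The state space \<open>[0, \<infinity>)\<close> with its Borel sets; kernels and laws live on it via the Giry monad.\<close>

definition Rplus :: "real measure" where
  "Rplus = restrict_space borel {0..}"

text \<open>The jump measure \<open>m\<close> is a measure on the Borel sets of \<open>(0, \<infinity>)\<close>.\<close>

definition admissible_jump_measure :: "real measure \<Rightarrow> bool" where
  "admissible_jump_measure m \<longleftrightarrow>
     sets m = sets (restrict_space borel {0<..}) \<and>
     finite_measure (density m (\<lambda>u. ennreal (min u (u\<^sup>2))))"

definition branching_mechanism :: "real \<Rightarrow> real \<Rightarrow> real measure \<Rightarrow> real \<Rightarrow> real" where
  "branching_mechanism b \<sigma> m z =
     b * z + 1/2 * \<sigma>\<^sup>2 * z\<^sup>2 + (\<integral>u. (exp (- z * u) - 1 + z * u) \<partial>m)"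

text \<open>\<open>v t z\<close> is the solution \<open>v\<^sub>t(z)\<close> of \<open>\<partial>v/\<partial>t = - \<phi>(v)\<close> started at \<open>z\<close>.
  For \<open>t, z \<ge> 0\<close> these conditions determine \<open>v\<close> uniquely when \<open>\<phi>\<close> is a branching mechanism, since \<open>\<phi>\<close> is then locally Lipschitz on \<open>[0, \<infinity>)\<close>; all other values of
  \<open>v\<close> are irrelevant. The derivative at \<open>t = 0\<close> is one-sided.\<close>

definition cumulant_flow :: "(real \<Rightarrow> real) \<Rightarrow> (real \<Rightarrow> real \<Rightarrow> real) \<Rightarrow> bool" where
  "cumulant_flow \<phi> v \<longleftrightarrow>
     (\<forall>z\<ge>0. v 0 z = z \<and>
        (\<forall>t\<ge>0. v t z \<ge> 0 \<and>
           ((\<lambda>s. v s z) has_real_derivative - \<phi> (v t z)) (at t within {0..})))"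

definition transition_semigroup :: "'s measure \<Rightarrow> (real \<Rightarrow> 's \<Rightarrow> 's measure) \<Rightarrow> bool" where
  "transition_semigroup S P \<longleftrightarrow>
     (\<forall>t\<ge>0. P t \<in> S \<rightarrow>\<^sub>M prob_algebra S) \<and>
     (\<forall>x\<in>space S. P 0 x = return S x) \<and>
     (\<forall>s\<ge>0. \<forall>t\<ge>0. \<forall>x\<in>space S. P (s + t) x = P s x \<bind> P t)"

definition cbi_semigroup ::
  "(real \<Rightarrow> real \<Rightarrow> real) \<Rightarrow> real \<Rightarrow> (real \<Rightarrow> real \<Rightarrow> real measure) \<Rightarrow> bool" where
  "cbi_semigroup v a P \<longleftrightarrow>
     transition_semigroup Rplus P \<and>
     (\<forall>t\<ge>0. \<forall>x\<ge>0. \<forall>z\<ge>0.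
        (\<integral>y. exp (- z * y) \<partial>P t x) = exp (- x * v t z - a * integral {0..t} (\<lambda>s. v s z)))"

definition stationary_distribution ::
  "'s measure \<Rightarrow> (real \<Rightarrow> 's \<Rightarrow> 's measure) \<Rightarrow> 's measure \<Rightarrow> bool" where
  "stationary_distribution S P \<mu> \<longleftrightarrow>
     \<mu> \<in> space (prob_algebra S) \<and> (\<forall>t\<ge>0. \<mu> \<bind> P t = \<mu>)"

text \<open>The measure \<open>\<mu>(dx\<^sub>0) P(t\<^sub>1 - t\<^sub>0, x\<^sub>0, dx\<^sub>1) \<dots> P(t\<^sub>n - t\<^sub>n\<^sub>-\<^sub>1, x\<^sub>n\<^sub>-\<^sub>1, dx\<^sub>n)\<close> on the product space
  indexed by \<open>{..n}\<close>, so it involves \<open>n + 1\<close> time points.\<close>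

primrec markov_fdd ::
  "'s measure \<Rightarrow> (real \<Rightarrow> 's \<Rightarrow> 's measure) \<Rightarrow> 's measure \<Rightarrow> (nat \<Rightarrow> real) \<Rightarrow> nat \<Rightarrow> (nat \<Rightarrow> 's) measure"
where
  "markov_fdd S P \<mu> t 0 = distr \<mu> (PiM {..0} (\<lambda>_. S)) (\<lambda>x. \<lambda>i\<in>{..0}. x)"
| "markov_fdd S P \<mu> t (Suc n) =
     markov_fdd S P \<mu> t n \<bind>
       (\<lambda>x. distr (P (t (Suc n) - t n) (x n)) (PiM {..Suc n} (\<lambda>_. S)) (\<lambda>y. x(Suc n := y)))"

definition markov_process_with_fdd ::
  "'w measure \<Rightarrow> 's measure \<Rightarrow> (real \<Rightarrow> 's \<Rightarrow> 's measure) \<Rightarrow> 's measure \<Rightarrow> (real \<Rightarrow> 'w \<Rightarrow> 's) \<Rightarrow> bool" where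
  "markov_process_with_fdd M S P \<mu> Y \<longleftrightarrow>
     (\<forall>t. Y t \<in> M \<rightarrow>\<^sub>M S) \<and>
     (\<forall>n t. strict_mono_on {..n} t \<longrightarrow>
        distr M (PiM {..n} (\<lambda>_. S)) (\<lambda>\<omega>. \<lambda>i\<in>{..n}. Y (t i) \<omega>) = markov_fdd S P \<mu> t n)"

definition generated_events ::
  "'w measure \<Rightarrow> 's measure \<Rightarrow> (real \<Rightarrow> 'w \<Rightarrow> 's) \<Rightarrow> real set \<Rightarrow> 'w set set" where
  "generated_events M S Y I =
     sigma_sets (space M) {Y s -` A \<inter> space M | s A. s \<in> I \<and> A \<in> sets S}"

definition mixing_coefficient ::
  "'w measure \<Rightarrow> 's measure \<Rightarrow> (real \<Rightarrow> 'w \<Rightarrow> 's) \<Rightarrow> real \<Rightarrow> real" where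
  "mixing_coefficient M S Y t =
     (SUP A\<in>generated_events M S Y {..0}. SUP B\<in>generated_events M S Y {t<..}.
        \<bar>measure M (A \<inter> B) - measure M A * measure M B\<bar>)"

end

theory Submission
  imports Defs
begin

text \<open>Let \<open>w\<close> bound \<open>v\<^sub>t(\<lambda>)\<close> for every \<open>\<lambda> \<ge> 0\<close>. In a continuous-state branching process,
  \<open>exp (- y w)\<close> bounds from below the probability that a population of initial size \<open>y\<close> is extinct
  at time \<open>t\<close>. By the branching property, the process started from \<open>y\<close> is the process started
  from \<open>0\<close> plus an independent copy without immigration started from \<open>y\<close>; on extinction of that copy
  the two coincide. Hence \<open>P\<^sub>t(y, \<cdot>) \<ge> exp (- y w) P\<^sub>t(0, \<cdot>)\<close> as measures
  (\<open>transition_dominates\<close>), so \<open>P\<^sub>t(y, \<cdot>)\<close> and \<open>P\<^sub>t(0, \<cdot>)\<close> differ by at most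
  \<open>1 - exp (- y w)\<close> on each event.

  The comparison is obtained from Laplace transforms alone, without constructing the process
  without immigration. Bernstein polynomials show that a difference of two finite
  measures whose transform, restricted to the natural numbers, is a completely monotone sequence is
  a positive measure (\<open>measure_le_of_laplace\<close>). The transform of
  \<open>P\<^sub>t(y, \<cdot>) - exp (- y w) P\<^sub>t(0, \<cdot>)\<close> is that of \<open>P\<^sub>t(0, \<cdot>)\<close> times
  \<open>exp (- y v\<^sub>t(\<lambda>)) - exp (- y w)\<close>, so what is needed is that
  \<open>\<lambda> \<mapsto> exp (- y v\<^sub>t(\<lambda>))\<close> is completely monotone on the natural numbers. This is the content of
  \<open>completely_monotone_exp_v\<close>: the explicit Euler scheme for \<open>\<partial>v/\<partial>t = - \<phi>(v)\<close>, with \<open>\<phi>\<close> replaced by a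
  mechanism that has finitely many jumps per unit time and no diffusion, iterates a map
  \<open>z \<mapsto> c z + \<integral> (1 - e\<^sup>-\<^sup>u\<^sup>z) \<nu>(du)\<close> with \<open>c \<ge> 0\<close>; such maps
  preserve complete monotonicity, and the scheme converges to \<open>v\<close>.

  Two facts about \<open>v\<close> make the comparison quantitative. As \<open>\<integral>\<^sub>\<theta>\<^sup>\<infinity> dz/\<phi>(z)\<close> is finite, \<open>v\<close>
  comes down from infinity: it is below \<open>\<theta>\<close> after a time \<open>T\<close> that does not depend on the
  starting point (\<open>v_descends_below\<close>). As \<open>\<phi>(z) \<ge> b z\<close>, it then decays like \<open>e\<^sup>-\<^sup>b\<^sup>t\<close>, so one may take
  \<open>w = \<theta> exp (- b (t - T))\<close>. Stationarity gives \<open>\<integral> (1 - exp (- w x)) \<mu>(dx) \<le> a w / b\<close>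
  (\<open>laplace_\<mu>_ge\<close>).

  Finally, by the Markov property a future event \<open>B\<close> has conditional probability \<open>g(Y\<^sub>0)\<close> given the past, with
  \<open>g = P\<^sub>t h\<close> and \<open>0 \<le> h \<le> 1\<close>. Comparing \<open>g\<close> with the constant \<open>g(0)\<close> bounds the
  covariance of a past and a future event by \<open>2 \<integral> (1 - exp (- w x)) \<mu>(dx)\<close>. This is proved for events that
  depend on finitely many times and passes to the generated \<open>\<sigma>\<close>-algebras by approximation in
  probability.\<close>

section \<open>Completely monotone sequences\<close>

text \<open>Non-negativity of the iterated differences \<open>f n - f (n + 1)\<close> up to order \<open>K\<close>. The recursion on the
  function, rather than an explicit formula for the iterated difference, turns every closure property into
  an induction on \<open>K\<close> with \<open>f\<close> generalised.\<close>

primrec monotone_order :: "nat \<Rightarrow> (nat \<Rightarrow> real) \<Rightarrow> bool" where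
  "monotone_order 0 f \<longleftrightarrow> (\<forall>n. 0 \<le> f n)"
| "monotone_order (Suc K) f \<longleftrightarrow> (\<forall>n. 0 \<le> f n) \<and> monotone_order K (\<lambda>n. f n - f (Suc n))"

definition completely_monotone :: "(nat \<Rightarrow> real) \<Rightarrow> bool" where
  "completely_monotone f \<longleftrightarrow> (\<forall>K. monotone_order K f)"

lemma monotone_order_Suc_imp: "monotone_order (Suc K) f \<Longrightarrow> monotone_order K f"
proof (induction K arbitrary: f)
  case (Suc K)
  from Suc.prems have "\<forall>n. 0 \<le> f n" "monotone_order (Suc K) (\<lambda>n. f n - f (Suc n))"
    unfolding monotone_order.simps by blast+
  with Suc.IH[of "\<lambda>n. f n - f (Suc n)"] show ?case unfolding monotone_order.simps by blast
qed simp

lemma monotone_order_shift: "monotone_order K f \<Longrightarrow> monotone_order K (\<lambda>n. f (Suc n))"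
proof (induction K arbitrary: f)
  case (Suc K)
  from Suc.prems Suc.IH[of "\<lambda>n. f n - f (Suc n)"] show ?case by simp
qed simp

lemma monotone_order_add:
  "monotone_order K f \<Longrightarrow> monotone_order K g \<Longrightarrow> monotone_order K (\<lambda>n. f n + g n)"
proof (induction K arbitrary: f g)
  case (Suc K)
  have "monotone_order K (\<lambda>n. (f n - f (Suc n)) + (g n - g (Suc n)))"
    by (rule Suc.IH) (use Suc.prems in simp_all)
  then show ?case using Suc.prems by (simp add: algebra_simps)
qed simp

lemma monotone_order_cmult:
  "monotone_order K f \<Longrightarrow> 0 \<le> c \<Longrightarrow> monotone_order K (\<lambda>n. c * f n)"
proof (induction K arbitrary: f)
  case (Suc K)
  have "monotone_order K (\<lambda>n. c * (f n - f (Suc n)))"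
    by (rule Suc.IH) (use Suc.prems in simp_all)
  then show ?case using Suc.prems by (simp add: algebra_simps)
qed simp

text \<open>The discrete Leibniz rule
  \<open>f n g n - f (n+1) g (n+1) = (f n - f (n+1)) g n + f (n+1) (g n - g (n+1))\<close> writes the difference of a product as
  a sum of products of lower order.\<close>

lemma monotone_order_mult:
  "monotone_order K f \<Longrightarrow> monotone_order K g \<Longrightarrow> monotone_order K (\<lambda>n. f n * g n)"
proof (induction K arbitrary: f g)
  case (Suc K)
  have "monotone_order K (\<lambda>n. (f n - f (Suc n)) * g n)"
    by (rule Suc.IH) (use Suc.prems(1) monotone_order_Suc_imp[OF Suc.prems(2)] in simp_all)
  moreover have "monotone_order K (\<lambda>n. f (Suc n) * (g n - g (Suc n)))"
    by (rule Suc.IH) (use Suc.prems(2) monotone_order_shift[OF monotone_order_Suc_imp[OF Suc.prems(1)]]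
        in simp_all)
  ultimately have "monotone_order K (\<lambda>n. (f n - f (Suc n)) * g n + f (Suc n) * (g n - g (Suc n)))"
    by (rule monotone_order_add)
  moreover have "(\<lambda>n. (f n - f (Suc n)) * g n + f (Suc n) * (g n - g (Suc n)))
      = (\<lambda>n. f n * g n - f (Suc n) * g (Suc n))"
    by (simp add: fun_eq_iff algebra_simps)
  ultimately have "monotone_order K (\<lambda>n. f n * g n - f (Suc n) * g (Suc n))"
    by (simp only:)
  moreover have "0 \<le> f n * g n" for n
    using Suc.prems by simp
  ultimately show ?case by simp
qed simp

lemma monotone_order_lim:
  assumes "\<And>j. monotone_order K (F j)" and "\<And>n. (\<lambda>j. F j n) \<longlonglongrightarrow> f n"
  shows "monotone_order K f"
  using assms
proof (induction K arbitrary: F f)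
  case 0
  have "0 \<le> f n" for n
    by (rule LIMSEQ_le_const[OF 0(2)]) (use 0(1) in simp)
  then show ?case by simp
next
  case (Suc K)
  have "monotone_order K (\<lambda>n. f n - f (Suc n))"
  proof (rule Suc.IH)
    show "monotone_order K (\<lambda>n. F j n - F j (Suc n))" for j
      using Suc.prems(1) by simp
    show "(\<lambda>j. F j n - F j (Suc n)) \<longlonglongrightarrow> f n - f (Suc n)" for n
      by (intro tendsto_diff Suc.prems(2))
  qed
  moreover have "0 \<le> f n" for n
    by (rule LIMSEQ_le_const[OF Suc.prems(2)]) (use Suc.prems(1) in simp)
  ultimately show ?case by simp
qed

lemma monotone_order_integral:
  fixes F :: "'u \<Rightarrow> nat \<Rightarrow> real"
  assumes "\<And>u. u \<in> space N \<Longrightarrow> monotone_order K (F u)" and "\<And>n. integrable N (\<lambda>u. F u n)"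
  shows "monotone_order K (\<lambda>n. \<integral>u. F u n \<partial>N)"
  using assms
proof (induction K arbitrary: F)
  case 0
  then show ?case by (auto intro!: integral_nonneg_AE)
next
  case (Suc K)
  have "monotone_order K (\<lambda>n. \<integral>u. F u n - F u (Suc n) \<partial>N)"
  proof (rule Suc.IH)
    show "monotone_order K (\<lambda>n. F u n - F u (Suc n))" if "u \<in> space N" for u
      using Suc.prems(1)[OF that] by simp
    show "integrable N (\<lambda>u. F u n - F u (Suc n))" for n
      by (intro Bochner_Integration.integrable_diff Suc.prems(2))
  qed
  then have "monotone_order K (\<lambda>n. (\<integral>u. F u n \<partial>N) - (\<integral>u. F u (Suc n) \<partial>N))"
    by (simp only: Bochner_Integration.integral_diff[OF Suc.prems(2) Suc.prems(2)])
  moreover have "0 \<le> (\<integral>u. F u n \<partial>N)" for n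
    by (rule Bochner_Integration.integral_nonneg) (use Suc.prems(1) in simp)
  ultimately show ?case by simp
qed

lemma completely_monotone_add:
  "completely_monotone f \<Longrightarrow> completely_monotone g \<Longrightarrow> completely_monotone (\<lambda>n. f n + g n)"
  by (simp add: completely_monotone_def monotone_order_add)

lemma completely_monotone_cmult:
  "completely_monotone f \<Longrightarrow> 0 \<le> c \<Longrightarrow> completely_monotone (\<lambda>n. c * f n)"
  by (simp add: completely_monotone_def monotone_order_cmult)

lemma completely_monotone_mult:
  "completely_monotone f \<Longrightarrow> completely_monotone g \<Longrightarrow> completely_monotone (\<lambda>n. f n * g n)"
  by (simp add: completely_monotone_def monotone_order_mult)

lemma completely_monotone_lim:
  "(\<And>j. completely_monotone (F j)) \<Longrightarrow> (\<And>n. (\<lambda>j. F j n) \<longlonglongrightarrow> f n) \<Longrightarrow> completely_monotone f"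
  by (auto simp: completely_monotone_def intro: monotone_order_lim)

lemma completely_monotone_integral:
  fixes F :: "'u \<Rightarrow> nat \<Rightarrow> real"
  shows "(\<And>u. u \<in> space N \<Longrightarrow> completely_monotone (F u)) \<Longrightarrow> (\<And>n. integrable N (\<lambda>u. F u n)) \<Longrightarrow>
    completely_monotone (\<lambda>n. \<integral>u. F u n \<partial>N)"
  by (auto simp: completely_monotone_def intro: monotone_order_integral)

lemma completely_monotone_const: "0 \<le> c \<Longrightarrow> completely_monotone (\<lambda>n. c)"
proof -
  have "monotone_order K (\<lambda>n. c)" if "0 \<le> c" for K and c :: real
  using that
  proof (induction K arbitrary: c)
    case (Suc K)
    from Suc.prems Suc.IH[of 0] show ?case by simp
  qed simp
  then show "0 \<le> c \<Longrightarrow> completely_monotone (\<lambda>n. c)" by (simp add: completely_monotone_def)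
qed

text \<open>Differences do not see additive constants, so only positivity can fail.\<close>

lemma completely_monotone_diff_const:
  assumes "completely_monotone f" and "\<And>n. c \<le> f n"
  shows "completely_monotone (\<lambda>n. f n - c)"
proof -
  have "monotone_order K (\<lambda>n. f n - c)" for K
  proof (cases K)
    case (Suc k)
    have "monotone_order (Suc k) f" using assms(1) unfolding completely_monotone_def by blast
    then show ?thesis using assms(2) Suc by simp
  qed (use assms(2) in simp)
  then show ?thesis by (simp add: completely_monotone_def)
qed

lemma completely_monotone_power_seq:
  assumes "0 \<le> s" "s \<le> 1"
  shows "completely_monotone (\<lambda>n. s ^ n)"
proof -
  have "monotone_order K (\<lambda>n. s ^ n)" for K
  proof (induction K)
    case (Suc K)
    have "monotone_order K (\<lambda>n. (1 - s) * s ^ n)"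
      using Suc assms by (intro monotone_order_cmult) auto
    then show ?case using assms by (simp add: algebra_simps)
  qed (use assms in auto)
  then show ?thesis by (simp add: completely_monotone_def)
qed

lemma completely_monotone_exp:
  assumes "completely_monotone f"
  shows "completely_monotone (\<lambda>n. exp (f n))"
proof (rule completely_monotone_lim)
  have pow: "completely_monotone (\<lambda>n. f n ^ k)" for k
    by (induction k) (use assms in \<open>auto intro!: completely_monotone_const completely_monotone_mult\<close>)
  show "completely_monotone (\<lambda>n. \<Sum>k<j. f n ^ k /\<^sub>R fact k)" for j
    by (induction j) (auto intro!: completely_monotone_const completely_monotone_add
        completely_monotone_cmult pow)
  show "(\<lambda>j. \<Sum>k<j. f n ^ k /\<^sub>R fact k) \<longlonglongrightarrow> exp (f n)" for n
    using exp_converges[of "f n"] by (simp add: sums_def)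
qed

section \<open>Laplace transforms at the natural numbers determine the order of measures\<close>

lemma completely_monotone_laplace:
  fixes N :: "real measure"
  assumes "finite_measure N" "sets N = sets Rplus"
  shows "completely_monotone (\<lambda>n. \<integral>y. exp (- real n * y) \<partial>N)"
proof (rule completely_monotone_integral)
  have sp: "space N = {0..}" using sets_eq_imp_space_eq[OF assms(2)] by (simp add: Rplus_def)
  have ms: "(\<lambda>y. exp (- real n * y)) \<in> borel_measurable N" for n
    unfolding measurable_cong_sets[OF assms(2) refl] Rplus_def by (rule measurable_restrict_space1) simp
  interpret finite_measure N by fact
  show "completely_monotone (\<lambda>n. exp (- real n * u))" if "u \<in> space N" for u
    using completely_monotone_power_seq[of "exp (- u)"] that sp by (simp add: exp_of_nat_mult[symmetric])
  show "integrable N (\<lambda>u. exp (- real n * u))" for n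
    by (rule integrable_const_bound[where B=1, OF _ ms]) (auto simp: sp intro!: AE_I2)
qed

text \<open>Under the substitution \<open>s = e\<^sup>-\<^sup>y\<close> the transform at \<open>n\<close> becomes the \<open>n\<close>-th moment of a measure on
  \<open>[0, 1]\<close>, and the \<open>k\<close>-th difference of the moments is the integral of \<open>s ^ n * (1 - s) ^ k\<close>.
  The additional exponent \<open>j\<close> makes the induction work.\<close>

lemma moment_le:
  fixes N1 N2 :: "real measure"
  assumes "finite_measure N1" "finite_measure N2"
    and "sets N1 = sets borel" "sets N2 = sets borel"
    and "AE s in N1. s \<in> {0..1}" "AE s in N2. s \<in> {0..1}"
    and "monotone_order k (\<lambda>n. (\<integral>s. s ^ n * (1 - s) ^ j \<partial>N2) - (\<integral>s. s ^ n * (1 - s) ^ j \<partial>N1))"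
  shows "(\<integral>s. s ^ n * (1 - s) ^ (k + j) \<partial>N1) \<le> (\<integral>s. s ^ n * (1 - s) ^ (k + j) \<partial>N2)"
  using assms(7)
proof (induction k arbitrary: j)
  case 0
  then show ?case by simp
next
  case (Suc k)
  have I: "integrable N (\<lambda>s. s ^ n * (1 - s) ^ j)"
    if "finite_measure N" "sets N = sets borel" "AE s in N. s \<in> {0..1}" for n j and N :: "real measure"
  proof -
    interpret finite_measure N by fact
    show ?thesis
    proof (rule integrable_const_bound[where B=1])
      show "AE s in N. norm (s ^ n * (1 - s) ^ j) \<le> 1"
        using that(3) by eventually_elim (auto simp: abs_mult power_abs intro!: mult_le_one power_le_one)
    qed (simp add: measurable_cong_sets[OF that(2) refl])
  qed
  have D: "(\<integral>s. s ^ n * (1 - s) ^ j \<partial>N) - (\<integral>s. s ^ Suc n * (1 - s) ^ j \<partial>N)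
      = (\<integral>s. s ^ n * (1 - s) ^ Suc j \<partial>N)"
    if "finite_measure N" "sets N = sets borel" "AE s in N. s \<in> {0..1}" for n j and N :: "real measure"
  proof -
    have "s ^ n * (1 - s) ^ Suc j = s ^ n * (1 - s) ^ j - s ^ Suc n * (1 - s) ^ j" for s :: real
      by (simp add: algebra_simps)
    then show ?thesis
      by (simp only: Bochner_Integration.integral_diff[OF I[OF that] I[OF that]])
  qed
  have "(\<lambda>n. (\<integral>s. s ^ n * (1 - s) ^ Suc j \<partial>N2) - (\<integral>s. s ^ n * (1 - s) ^ Suc j \<partial>N1)) =
     (\<lambda>n. ((\<integral>s. s ^ n * (1 - s) ^ j \<partial>N2) - (\<integral>s. s ^ n * (1 - s) ^ j \<partial>N1)) -
        ((\<integral>s. s ^ Suc n * (1 - s) ^ j \<partial>N2) - (\<integral>s. s ^ Suc n * (1 - s) ^ j \<partial>N1)))"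
    using D[OF assms(1,3,5), of _ j] D[OF assms(2,4,6), of _ j] by (auto simp: fun_eq_iff algebra_simps)
  then have "monotone_order k (\<lambda>n. (\<integral>s. s ^ n * (1 - s) ^ Suc j \<partial>N2) - (\<integral>s. s ^ n * (1 - s) ^ Suc j \<partial>N1))"
    using Suc.prems by simp
  from Suc.IH[OF this] show ?case by simp
qed

text \<open>The Bernstein polynomials of a non-negative function are non-negative combinations of the
  functions \<open>s ^ k * (1 - s) ^ (N - k)\<close>, for which \<open>moment_le\<close> gives the inequality, and they converge uniformly.\<close>

lemma continuous_integral_le_of_moments:
  fixes N1 N2 :: "real measure" and f :: "real \<Rightarrow> real"
  assumes "finite_measure N1" "finite_measure N2"
    and "sets N1 = sets borel" "sets N2 = sets borel"
    and "AE s in N1. s \<in> {0..1}" "AE s in N2. s \<in> {0..1}"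
    and "completely_monotone (\<lambda>n. (\<integral>s. s ^ n \<partial>N2) - (\<integral>s. s ^ n \<partial>N1))"
    and f: "continuous_on UNIV f" "\<And>s. 0 \<le> f s"
  shows "(\<integral>s. f s \<partial>N1) \<le> (\<integral>s. f s \<partial>N2)"
proof -
  have cont01: "continuous_on {0..1} f" using f(1) continuous_on_subset by blast
  have fm: "f \<in> borel_measurable borel" by (rule borel_measurable_continuous_onI[OF f(1)])
  obtain B0 where B0: "\<And>s. s \<in> {0..1} \<Longrightarrow> norm (f s) \<le> B0"
    using compact_imp_bounded[OF compact_continuous_image[OF cont01]] unfolding bounded_iff by blast
  define p where "p N s = (\<Sum>k\<le>N. f (real k / real N) * Bernstein N k s)" for N s
  have pm: "p N \<in> borel_measurable borel" for N
    unfolding p_def Bernstein_def by measurable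
  have lim: "(\<lambda>N. p N s) \<longlonglongrightarrow> f s" if "s \<in> {0..1}" for s
  proof (rule LIMSEQ_I)
    fix r :: real assume "0 < r"
    from Bernstein_Weierstrass[OF cont01 this] obtain N0 where
      "\<And>n x. N0 \<le> n \<Longrightarrow> x \<in> {0..1} \<Longrightarrow> \<bar>f x - p n x\<bar> < r" unfolding p_def by blast
    then show "\<exists>no. \<forall>n\<ge>no. norm (p n s - f s) < r" using that by (auto simp: abs_minus_commute)
  qed
  have bound: "\<bar>p N s\<bar> \<le> B0" if "s \<in> {0..1}" for N s
  proof -
    have "\<bar>p N s\<bar> \<le> (\<Sum>k\<le>N. B0 * Bernstein N k s)"
      unfolding p_def
    proof (rule order_trans[OF sum_abs], rule sum_mono)
      fix k assume "k \<in> {..N}"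
      then have "real k / real N \<in> {0..1}" by (cases "N = 0") auto
      from B0[OF this] show "\<bar>f (real k / real N) * Bernstein N k s\<bar> \<le> B0 * Bernstein N k s"
        using that Bernstein_nonneg[of s N k] by (simp add: abs_mult mult_right_mono)
    qed
    also have "\<dots> = B0" using sum_Bernstein[of N s] by (simp flip: sum_distrib_left)
    finally show ?thesis .
  qed
  have conv: "(\<lambda>N. \<integral>s. p N s \<partial>M) \<longlonglongrightarrow> (\<integral>s. f s \<partial>M)"
    if "finite_measure M" "sets M = sets borel" "AE s in M. s \<in> {0..1}" for M
  proof -
    interpret finite_measure M by fact
    show ?thesis
    proof (rule integral_dominated_convergence[where w="\<lambda>_. B0"])
      show "AE s in M. (\<lambda>N. p N s) \<longlonglongrightarrow> f s" using that(3) by eventually_elim (rule lim)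
      show "AE s in M. norm (p N s) \<le> B0" for N using that(3) by eventually_elim (use bound in auto)
    qed (use fm pm in \<open>auto simp: measurable_cong_sets[OF that(2) refl]\<close>)
  qed
  have pint: "(\<integral>s. p N s \<partial>M) = (\<Sum>k\<le>N. f (real k / real N) * (real (N choose k) * (\<integral>s. s ^ k * (1 - s) ^ (N - k) \<partial>M)))"
    if "finite_measure M" "sets M = sets borel" "AE s in M. s \<in> {0..1}" for N M
  proof -
    interpret finite_measure M by fact
    have I: "integrable M (\<lambda>s. s ^ n * (1 - s) ^ j)" for n j
    proof (rule integrable_const_bound[where B=1])
      show "AE s in M. norm (s ^ n * (1 - s) ^ j) \<le> 1"
        using that(3) by eventually_elim (auto simp: abs_mult power_abs intro!: mult_le_one power_le_one)
    qed (simp add: measurable_cong_sets[OF that(2) refl])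
    show ?thesis unfolding p_def Bernstein_def using I
      by (subst Bochner_Integration.integral_sum) (auto simp: mult.assoc)
  qed
  have "(\<integral>s. p N s \<partial>N1) \<le> (\<integral>s. p N s \<partial>N2)" for N
    unfolding pint[OF assms(1,3,5)] pint[OF assms(2,4,6)]
  proof (rule sum_mono, intro mult_left_mono f(2))
    fix k assume "k \<in> {..N}"
    show "(\<integral>s. s ^ k * (1 - s) ^ (N - k) \<partial>N1) \<le> (\<integral>s. s ^ k * (1 - s) ^ (N - k) \<partial>N2)"
      using moment_le[OF assms(1-6), of "N - k" 0 k] assms(7) by (simp add: completely_monotone_def)
  qed simp
  then show ?thesis
    by (intro LIMSEQ_le[OF conv[OF assms(1,3,5)] conv[OF assms(2,4,6)]]) auto
qed

text \<open>The indicator of a closed set is a limit of continuous functions, and finite Borel measures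
  on the line are inner regular.\<close>

lemma measure_le_of_moments:
  fixes N1 N2 :: "real measure"
  assumes N: "finite_measure N1" "finite_measure N2"
    "sets N1 = sets borel" "sets N2 = sets borel"
    "AE s in N1. s \<in> {0..1}" "AE s in N2. s \<in> {0..1}"
    "completely_monotone (\<lambda>n. (\<integral>s. s ^ n \<partial>N2) - (\<integral>s. s ^ n \<partial>N1))"
    and B: "B \<in> sets borel"
  shows "emeasure N1 B \<le> emeasure N2 B"
proof -
  interpret N1: finite_measure N1 by fact
  interpret N2: finite_measure N2 by fact
  have closed: "emeasure N1 C \<le> emeasure N2 C" if C: "closed C" "C \<noteq> {}" for C
  proof -
    define f where "f j s = max 0 (1 - real j * infdist s C)" for j s
    have fc: "continuous_on UNIV (f j)" for j
      unfolding f_def by (intro continuous_intros)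
    have fm: "f j \<in> borel_measurable borel" for j
      by (rule borel_measurable_continuous_onI[OF fc])
    have f_abs: "\<bar>f j s\<bar> \<le> 1" for j s by (simp add: f_def infdist_nonneg)
    have lim: "(\<lambda>j. f j s) \<longlonglongrightarrow> indicator C s" for s
    proof (cases "s \<in> C")
      case True
      then show ?thesis by (simp add: f_def)
    next
      case False
      then have d: "0 < infdist s C"
        using C in_closed_iff_infdist_zero[of C s] infdist_nonneg[of s C] by linarith
      obtain j0 where j0: "1 < real j0 * infdist s C" using reals_Archimedean3[OF d] by blast
      have "f j s = 0" if "j0 \<le> j" for j
      proof -
        have "real j0 * infdist s C \<le> real j * infdist s C" using that d by (intro mult_right_mono) auto
        then show ?thesis using j0 by (simp add: f_def)
      qed
      then have "\<forall>\<^sub>F j in sequentially. f j s = indicator C s"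
        using False eventually_sequentially by auto
      then show ?thesis by (rule tendsto_eventually)
    qed
    have conv: "(\<lambda>j. \<integral>s. f j s \<partial>M) \<longlonglongrightarrow> measure M C"
      if "finite_measure M" "sets M = sets borel" for M
    proof -
      interpret finite_measure M by fact
      have "(\<lambda>j. \<integral>s. f j s \<partial>M) \<longlonglongrightarrow> (\<integral>s. indicator C s \<partial>M)"
        by (rule integral_dominated_convergence[where w="\<lambda>_. 1"])
          (use fm lim C that in \<open>auto simp: measurable_cong_sets[OF that(2) refl] f_abs\<close>)
      then show ?thesis using sets_eq_imp_space_eq[OF that(2)] by simp
    qed
    have "measure N1 C \<le> measure N2 C"
      by (intro LIMSEQ_le[OF conv[OF N(1,3)] conv[OF N(2,4)]] exI[of _ 0] allI impI
          continuous_integral_le_of_moments[OF N fc]) (simp add: f_def)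
    then show ?thesis by (simp add: N1.emeasure_eq_measure N2.emeasure_eq_measure)
  qed
  have "emeasure N1 B = (SUP K\<in>{K. K \<subseteq> B \<and> compact K}. emeasure N1 K)"
    using inner_regular[of N1 B] N(3) B N1.emeasure_finite by auto
  also have "\<dots> \<le> emeasure N2 B"
  proof (rule SUP_least)
    fix K assume K: "K \<in> {K. K \<subseteq> B \<and> compact K}"
    then have "emeasure N1 K \<le> emeasure N2 K"
      using closed[of K] compact_imp_closed by (cases "K = {}") auto
    also have "\<dots> \<le> emeasure N2 B" using K B N(4) by (intro emeasure_mono) auto
    finally show "emeasure N1 K \<le> emeasure N2 B" .
  qed
  finally show ?thesis .
qed

lemma measure_le_of_laplace:
  fixes N1 N2 :: "real measure"
  assumes N: "finite_measure N1" "finite_measure N2"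
    "sets N1 = sets Rplus" "sets N2 = sets Rplus"
    "completely_monotone (\<lambda>n. (\<integral>y. exp (- real n * y) \<partial>N2) - (\<integral>y. exp (- real n * y) \<partial>N1))"
  shows "N1 \<le> N2"
proof -
  define e :: "real \<Rightarrow> real" where "e = (\<lambda>y. exp (- y))"
  have em: "e \<in> Rplus \<rightarrow>\<^sub>M borel" unfolding e_def Rplus_def
    by (rule measurable_restrict_space1) simp
  have emN: "e \<in> M \<rightarrow>\<^sub>M borel" if "sets M = sets Rplus" for M
    using em by (simp add: measurable_cong_sets[OF that refl])
  have sp: "space M = {0..}" if "sets M = sets Rplus" for M :: "real measure"
    using sets_eq_imp_space_eq[OF that] by (simp add: Rplus_def)
  have ae: "AE s in distr M borel e. s \<in> {0..1}" if "sets M = sets Rplus" for M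
    by (subst AE_distr_iff[OF emN[OF that]]) (auto simp: e_def sp[OF that])
  have mom: "(\<integral>s. s ^ n \<partial>distr M borel e) = (\<integral>y. exp (- real n * y) \<partial>M)"
    if "sets M = sets Rplus" for M n
    by (subst integral_distr[OF emN[OF that]]) (auto simp: e_def exp_of_nat_mult[symmetric])
  have le: "emeasure (distr N1 borel e) B \<le> emeasure (distr N2 borel e) B" if "B \<in> sets borel" for B
    using N that by (intro measure_le_of_moments finite_measure.finite_measure_distr emN ae)
      (simp_all add: mom)
  have "emeasure N1 B \<le> emeasure N2 B" for B
  proof (cases "B \<in> sets Rplus")
    case True
    define B' where "B' = {s. 0 < s \<and> - ln s \<in> B}"
    have "B \<in> sets borel" "B \<subseteq> {0..}" using True by (auto simp: Rplus_def sets_restrict_space)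
    then have B': "B' \<in> sets borel" unfolding B'_def by measurable
    have eq: "e -` B' \<inter> space M = B" if "sets M = sets Rplus" for M
      using \<open>B \<subseteq> {0..}\<close> unfolding sp[OF that] by (auto simp: e_def B'_def)
    show ?thesis using le[OF B'] N B' eq by (simp add: emeasure_distr emN)
  next
    case False
    then show ?thesis using N by (simp add: emeasure_notin_sets)
  qed
  then show ?thesis using N by (auto simp: le_measure)
qed

section \<open>Bernstein sequences\<close>

text \<open>The discrete analogue of Bernstein functions, which are the functions \<open>f \<ge> 0\<close> such that \<open>e\<^sup>-\<^sup>x\<^sup>f\<close> is
  completely monotone for all \<open>x \<ge> 0\<close>. In this form the closure properties reduce to those of completely
  monotone sequences.\<close>

definition bernstein_seq :: "(nat \<Rightarrow> real) \<Rightarrow> bool" where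
  "bernstein_seq f \<longleftrightarrow> (\<forall>n. 0 \<le> f n) \<and> (\<forall>x\<ge>0. completely_monotone (\<lambda>n. exp (- x * f n)))"

lemma bernstein_seq_nonneg: "bernstein_seq f \<Longrightarrow> 0 \<le> f n"
  by (simp add: bernstein_seq_def)

lemma bernstein_seq_exp: "bernstein_seq f \<Longrightarrow> 0 \<le> x \<Longrightarrow> completely_monotone (\<lambda>n. exp (- x * f n))"
  by (simp add: bernstein_seq_def)

lemma bernstein_seq_real: "bernstein_seq real"
  unfolding bernstein_seq_def
proof (intro conjI allI impI)
  fix x :: real assume "0 \<le> x"
  then have "completely_monotone (\<lambda>n. exp (- x) ^ n)"
    by (intro completely_monotone_power_seq) auto
  then show "completely_monotone (\<lambda>n. exp (- x * real n))"
    by (simp add: exp_of_nat_mult[symmetric] mult.commute)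
qed simp

lemma bernstein_seq_add:
  assumes "bernstein_seq f" "bernstein_seq g"
  shows "bernstein_seq (\<lambda>n. f n + g n)"
  unfolding bernstein_seq_def
proof (intro conjI allI impI)
  fix x :: real assume "0 \<le> x"
  then have "completely_monotone (\<lambda>n. exp (- x * f n) * exp (- x * g n))"
    using assms by (intro completely_monotone_mult bernstein_seq_exp)
  then show "completely_monotone (\<lambda>n. exp (- x * (f n + g n)))"
    by (simp add: exp_add[symmetric] distrib_left)
qed (simp add: assms bernstein_seq_nonneg)

lemma bernstein_seq_cmult:
  assumes "bernstein_seq f" "0 \<le> c"
  shows "bernstein_seq (\<lambda>n. c * f n)"
  unfolding bernstein_seq_def
proof (intro conjI allI impI)
  fix x :: real assume "0 \<le> x"
  then have "completely_monotone (\<lambda>n. exp (- (x * c) * f n))"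
    using assms by (intro bernstein_seq_exp) auto
  then show "completely_monotone (\<lambda>n. exp (- x * (c * f n)))"
    by (simp add: mult.assoc)
qed (simp add: assms bernstein_seq_nonneg)

lemma bernstein_seq_const_minus:
  assumes "completely_monotone g" "\<And>n. g n \<le> c"
  shows "bernstein_seq (\<lambda>n. c - g n)"
  unfolding bernstein_seq_def
proof (intro conjI allI impI)
  fix x :: real assume "0 \<le> x"
  then have "completely_monotone (\<lambda>n. exp (- x * c) * exp (x * g n))"
    using assms by (intro completely_monotone_cmult completely_monotone_exp) auto
  then show "completely_monotone (\<lambda>n. exp (- x * (c - g n)))"
    by (simp add: exp_add[symmetric] algebra_simps)
qed (simp add: assms)

section \<open>The branching mechanism\<close>

definition compensated_exp :: "real \<Rightarrow> real" where
  "compensated_exp x = exp (- x) - 1 + x"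

lemma compensated_exp_0 [simp]: "compensated_exp 0 = 0"
  by (simp add: compensated_exp_def)

lemma compensated_exp_mono:
  assumes "0 \<le> x" "x \<le> y"
  shows "compensated_exp x \<le> compensated_exp y"
proof -
  have "exp (- x) - exp (- y) = exp (- x) * (1 - exp (- (y - x)))"
    by (simp add: algebra_simps exp_add[symmetric])
  also have "\<dots> \<le> 1 * (y - x)"
    using assms exp_ge_add_one_self[of "- (y - x)"] by (intro mult_mono) (auto simp: algebra_simps)
  finally show ?thesis by (simp add: compensated_exp_def)
qed

lemma compensated_exp_nonneg: "0 \<le> x \<Longrightarrow> 0 \<le> compensated_exp x"
  using compensated_exp_mono[of 0 x] by simp

lemma compensated_exp_diff_le:
  assumes "0 \<le> x" "x \<le> y"
  shows "compensated_exp y - compensated_exp x \<le> (y - x) * min 1 y"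
proof -
  have "exp (- y) * (y - x) \<le> exp (- y) * (exp (y - x) - 1)"
    using exp_ge_add_one_self[of "y - x"] by (intro mult_left_mono) (linarith, simp)
  also have "\<dots> = exp (- x) - exp (- y)"
    by (simp add: algebra_simps exp_add[symmetric])
  finally have "compensated_exp y - compensated_exp x \<le> (y - x) * (1 - exp (- y))"
    by (simp add: compensated_exp_def algebra_simps)
  also have "\<dots> \<le> (y - x) * min 1 y"
    using assms exp_ge_add_one_self[of "- y"] by (intro mult_left_mono) auto
  finally show ?thesis .
qed

text \<open>The second-order Taylor bounds that compare a jump term of size \<open>\<delta>\<close> with the diffusion term. The constant
  in front of \<open>x ^ 3\<close> is not optimal.\<close>

lemma compensated_exp_le: "0 \<le> x \<Longrightarrow> compensated_exp x \<le> x\<^sup>2 / 2"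
proof -
  assume x: "0 \<le> x"
  obtain t where "exp (- x) = (\<Sum>m<3. (- x) ^ m / fact m) + (exp t / fact 3) * (- x) ^ 3"
    using Maclaurin_exp_le[of "- x" 3] by blast
  then have "exp (- x) = 1 - x + x\<^sup>2 / 2 - exp t / 6 * x ^ 3"
    by (simp add: numeral_3_eq_3 power2_eq_square fact_numeral)
  moreover have "0 \<le> exp t / 6 * x ^ 3" using x by simp
  ultimately show ?thesis by (simp add: compensated_exp_def)
qed

lemma compensated_exp_ge: "0 \<le> x \<Longrightarrow> x\<^sup>2 / 2 - x ^ 3 \<le> compensated_exp x"
proof -
  assume x: "0 \<le> x"
  obtain t where t: "\<bar>t\<bar> \<le> \<bar>- x\<bar>" "exp (- x) = (\<Sum>m<4. (- x) ^ m / fact m) + (exp t / fact 4) * (- x) ^ 4"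
    using Maclaurin_exp_le[of "- x" 4] by blast
  have "(\<Sum>m<4. (- x) ^ m / fact m) = 1 - x + x\<^sup>2 / 2 - x ^ 3 / 6"
    by (simp add: eval_nat_numeral fact_numeral)
  moreover have "0 \<le> (exp t / fact 4) * (- x) ^ 4" by simp
  moreover have "0 \<le> x ^ 3" using x by simp
  ultimately show ?thesis using t(2) unfolding compensated_exp_def by linarith
qed

locale subcritical_mechanism =
  fixes b \<sigma> :: real and m :: "real measure"
  assumes b_pos: "0 < b" and jumps: "admissible_jump_measure m"
begin

abbreviation \<phi> :: "real \<Rightarrow> real" where
  "\<phi> \<equiv> branching_mechanism b \<sigma> m"

lemma space_m: "space m = {0<..}"
proof -
  have "sets m = sets (restrict_space borel {0<..})" using jumps by (simp add: admissible_jump_measure_def)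
  from sets_eq_imp_space_eq[OF this] show ?thesis by simp
qed

lemma measurable_m: "f \<in> borel_measurable borel \<Longrightarrow> f \<in> borel_measurable m" for f :: "real \<Rightarrow> real"
proof -
  have s: "sets m = sets (restrict_space borel {0<..})" using jumps by (simp add: admissible_jump_measure_def)
  show "f \<in> borel_measurable borel \<Longrightarrow> f \<in> borel_measurable m"
    unfolding measurable_cong_sets[OF s refl] by (rule measurable_restrict_space1)
qed

lemma integrable_min: "integrable m (\<lambda>u. min u (u\<^sup>2))"
proof (rule integrableI_bounded)
  show meas: "(\<lambda>u. min u (u\<^sup>2)) \<in> borel_measurable m" by (rule measurable_m) simp
  have "finite_measure (density m (\<lambda>u. ennreal (min u (u\<^sup>2))))"
    using jumps by (simp add: admissible_jump_measure_def)
  then have "emeasure (density m (\<lambda>u. ennreal (min u (u\<^sup>2)))) (space m) < \<infinity>"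
    using finite_measure.emeasure_finite[of "density m (\<lambda>u. ennreal (min u (u\<^sup>2)))" "space m"]
    by (simp add: top.not_eq_extremum)
  also have "emeasure (density m (\<lambda>u. ennreal (min u (u\<^sup>2)))) (space m) = (\<integral>\<^sup>+u. ennreal (norm (min u (u\<^sup>2))) \<partial>m)"
    using meas by (subst emeasure_density) (auto intro!: nn_integral_cong simp: space_m sets.top[of m, unfolded space_m])
  finally show "(\<integral>\<^sup>+u. ennreal (norm (min u (u\<^sup>2))) \<partial>m) < \<infinity>" .
qed

lemma integrable_dominated:
  assumes "f \<in> borel_measurable borel" and "\<And>u. 0 < u \<Longrightarrow> \<bar>f u\<bar> \<le> C * min u (u\<^sup>2)"
  shows "integrable m f"
proof (rule Bochner_Integration.integrable_bound)
  show "integrable m (\<lambda>u. C * min u (u\<^sup>2))" using integrable_min by simp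
  show "AE u in m. norm (f u) \<le> norm (C * min u (u\<^sup>2))"
  proof (rule AE_I2)
    fix u assume "u \<in> space m"
    then have "\<bar>f u\<bar> \<le> C * min u (u\<^sup>2)" by (intro assms(2)) (simp add: space_m)
    then show "norm (f u) \<le> norm (C * min u (u\<^sup>2))" by simp
  qed
  show "f \<in> borel_measurable m" by (rule measurable_m[OF assms(1)])
qed

text \<open>The derivative of \<open>z \<mapsto> compensated_exp (z u)\<close> is at most \<open>u min (1, z u)\<close>; the weight
  \<open>min u (u\<^sup>2)\<close> is the one that \<open>m\<close> integrates, so \<open>\<phi>\<close> is locally Lipschitz.\<close>

lemma jump_diff_le:
  assumes "0 \<le> z" "z \<le> y" "y \<le> c" "0 < u"
  shows "compensated_exp (y * u) - compensated_exp (z * u) \<le> (y - z) * (max 1 c * min u (u\<^sup>2))"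
proof -
  have "compensated_exp (y * u) - compensated_exp (z * u) \<le> (y * u - z * u) * min 1 (y * u)"
    using assms by (intro compensated_exp_diff_le mult_right_mono) auto
  also have "\<dots> = (y - z) * (u * min 1 (y * u))" by (simp add: algebra_simps)
  also have "\<dots> \<le> (y - z) * (max 1 c * min u (u\<^sup>2))"
  proof (rule mult_left_mono)
    have 1: "u * min 1 (y * u) \<le> max 1 c * u"
    proof -
      have "u * min 1 (y * u) \<le> u * max 1 c" using assms by (intro mult_left_mono) auto
      then show ?thesis by (simp add: mult.commute)
    qed
    have 2: "u * min 1 (y * u) \<le> max 1 c * u\<^sup>2"
    proof -
      have "u * min 1 (y * u) \<le> u * (max 1 c * u)"
        using assms by (intro mult_left_mono) (auto intro!: min.coboundedI2 mult_right_mono)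
      then show ?thesis by (simp add: power2_eq_square mult_ac)
    qed
    show "u * min 1 (y * u) \<le> max 1 c * min u (u\<^sup>2)"
      using 1 2 by (simp add: min_def)
  qed (use assms in simp)
  finally show ?thesis .
qed

lemma compensated_exp_measurable: "(\<lambda>u. compensated_exp (z * u)) \<in> borel_measurable borel"
  unfolding compensated_exp_def by measurable

lemma integrable_jump:
  assumes "0 \<le> z" shows "integrable m (\<lambda>u. compensated_exp (z * u))"
proof (rule integrable_dominated)
  show "\<bar>compensated_exp (z * u)\<bar> \<le> (z * max 1 z) * min u (u\<^sup>2)" if "0 < u" for u
    using jump_diff_le[of 0 z z u] compensated_exp_nonneg[of "z * u"] assms that by (simp add: mult.assoc)
qed (rule compensated_exp_measurable)

lemma phi_eq: "\<phi> z = b * z + \<sigma>\<^sup>2 * (z\<^sup>2 / 2) + (\<integral>u. compensated_exp (z * u) \<partial>m)"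
  by (simp add: branching_mechanism_def compensated_exp_def)

lemma phi_diff_ge:
  assumes "0 \<le> z" "z \<le> y" shows "b * (y - z) \<le> \<phi> y - \<phi> z"
proof -
  have "(\<integral>u. compensated_exp (z * u) \<partial>m) \<le> (\<integral>u. compensated_exp (y * u) \<partial>m)"
    using assms by (intro integral_mono integrable_jump compensated_exp_mono) (auto simp: space_m mult_right_mono)
  moreover have "\<sigma>\<^sup>2 * (z\<^sup>2 / 2) \<le> \<sigma>\<^sup>2 * (y\<^sup>2 / 2)"
    using assms by (intro mult_left_mono divide_right_mono power_mono) auto
  ultimately show ?thesis by (simp add: phi_eq algebra_simps)
qed

lemma phi_0 [simp]: "\<phi> 0 = 0"
  by (simp add: phi_eq)

lemma phi_ge: "0 \<le> z \<Longrightarrow> b * z \<le> \<phi> z"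
  using phi_diff_ge[of 0 z] by simp

lemma phi_nonneg: "0 \<le> z \<Longrightarrow> 0 \<le> \<phi> z"
  using phi_ge[of z] b_pos mult_nonneg_nonneg[of b z] by linarith

lemma phi_mono: "0 \<le> z \<Longrightarrow> z \<le> y \<Longrightarrow> \<phi> z \<le> \<phi> y"
  using phi_diff_ge[of z y] b_pos mult_nonneg_nonneg[of b "y - z"] by linarith

definition lipschitz_bound :: "real \<Rightarrow> real" where
  "lipschitz_bound c = b + \<sigma>\<^sup>2 * c + max 1 c * (\<integral>u. min u (u\<^sup>2) \<partial>m)"

lemma phi_diff_le:
  assumes "0 \<le> z" "z \<le> y" "y \<le> c" shows "\<phi> y - \<phi> z \<le> lipschitz_bound c * (y - z)"
proof -
  have "(\<integral>u. compensated_exp (y * u) \<partial>m) - (\<integral>u. compensated_exp (z * u) \<partial>m)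
      = (\<integral>u. compensated_exp (y * u) - compensated_exp (z * u) \<partial>m)"
    using assms by (intro Bochner_Integration.integral_diff[symmetric] integrable_jump) auto
  also have "\<dots> \<le> (\<integral>u. (y - z) * (max 1 c * min u (u\<^sup>2)) \<partial>m)"
    using assms by (intro integral_mono jump_diff_le Bochner_Integration.integrable_diff integrable_jump)
      (auto simp: space_m intro!: integrable_mult_right integrable_min)
  also have "\<dots> = (y - z) * (max 1 c * (\<integral>u. min u (u\<^sup>2) \<partial>m))" by simp
  finally have 1: "(\<integral>u. compensated_exp (y * u) \<partial>m) - (\<integral>u. compensated_exp (z * u) \<partial>m)
      \<le> (y - z) * (max 1 c * (\<integral>u. min u (u\<^sup>2) \<partial>m))" .
  have "y\<^sup>2 / 2 - z\<^sup>2 / 2 = (y - z) * ((y + z) / 2)" by (simp add: power2_eq_square algebra_simps)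
  also have "\<dots> \<le> (y - z) * c" using assms by (intro mult_left_mono) auto
  finally have "\<sigma>\<^sup>2 * (y\<^sup>2 / 2 - z\<^sup>2 / 2) \<le> \<sigma>\<^sup>2 * ((y - z) * c)" by (intro mult_left_mono) auto
  then have "\<phi> y - \<phi> z \<le> b * (y - z) + \<sigma>\<^sup>2 * ((y - z) * c) + (y - z) * (max 1 c * (\<integral>u. min u (u\<^sup>2) \<partial>m))"
    using 1 by (simp add: phi_eq algebra_simps)
  also have "\<dots> = lipschitz_bound c * (y - z)" by (simp add: lipschitz_bound_def algebra_simps)
  finally show ?thesis .
qed

lemma lipschitz_bound_nonneg: "0 \<le> c \<Longrightarrow> 0 \<le> lipschitz_bound c"
  unfolding lipschitz_bound_def using b_pos
  by (auto intro!: add_nonneg_nonneg mult_nonneg_nonneg Bochner_Integration.integral_nonneg simp: space_m)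

lemma phi_abs_diff_le:
  assumes "z \<in> {0..c}" "y \<in> {0..c}" shows "\<bar>\<phi> y - \<phi> z\<bar> \<le> lipschitz_bound c * \<bar>y - z\<bar>"
  using assms phi_diff_le[of z y c] phi_diff_le[of y z c] phi_mono[of z y] phi_mono[of y z]
  by (cases "z \<le> y") (auto simp: abs_if)

lemma phi_continuous: "continuous_on {0..} \<phi>"
  unfolding continuous_on_iff
proof (intro ballI allI impI)
  fix z e :: real assume z: "z \<in> {0..}" and e: "0 < e"
  define L where "L = lipschitz_bound (z + 1) + 1"
  have L: "0 < L" using lipschitz_bound_nonneg[of "z + 1"] z by (simp add: L_def)
  show "\<exists>d>0. \<forall>y\<in>{0..}. dist y z < d \<longrightarrow> dist (\<phi> y) (\<phi> z) < e"
  proof (intro exI[of _ "min 1 (e / L)"] conjI ballI impI)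
    fix y :: real assume y: "y \<in> {0..}" "dist y z < min 1 (e / L)"
    have "\<bar>\<phi> y - \<phi> z\<bar> \<le> lipschitz_bound (z + 1) * \<bar>y - z\<bar>"
      using y z by (intro phi_abs_diff_le) (auto simp: dist_real_def)
    also have "\<dots> \<le> L * \<bar>y - z\<bar>" by (intro mult_right_mono) (auto simp: L_def)
    also have "\<dots> < e" using y L by (simp add: dist_real_def field_simps)
    finally show "dist (\<phi> y) (\<phi> z) < e" by (simp add: dist_real_def)
  qed (use e L in auto)
qed

end

section \<open>The Euler scheme preserves Bernstein sequences\<close>

text \<open>Stability of a one-step scheme: since \<open>S\<close> does not expand distances, the local errors \<open>e\<close> merely add up.\<close>

lemma contraction_iterates_close:
  fixes w :: "nat \<Rightarrow> real"
  assumes "\<And>y z. 0 \<le> y \<Longrightarrow> 0 \<le> z \<Longrightarrow> \<bar>S y - S z\<bar> \<le> \<bar>y - z\<bar>"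
    and "\<And>z. 0 \<le> z \<Longrightarrow> 0 \<le> S z" and "\<And>k. 0 \<le> w k"
    and "\<And>k. \<bar>w (Suc k) - S (w k)\<bar> \<le> e"
  shows "\<bar>w k - (S ^^ k) (w 0)\<bar> \<le> real k * e"
proof (induction k)
  case (Suc k)
  have nn: "0 \<le> (S ^^ k) (w 0)" by (induction k) (auto simp: assms)
  have "\<bar>w (Suc k) - (S ^^ Suc k) (w 0)\<bar> \<le> \<bar>w (Suc k) - S (w k)\<bar> + \<bar>S (w k) - S ((S ^^ k) (w 0))\<bar>"
    by simp
  also have "\<dots> \<le> e + \<bar>w k - (S ^^ k) (w 0)\<bar>"
    by (intro add_mono assms nn)
  finally show ?case using Suc by (simp add: algebra_simps)
qed simp

context subcritical_mechanism begin

text \<open>Jumps below \<open>\<delta>\<close> are dropped and the diffusion \<open>\<sigma>\<^sup>2 z\<^sup>2 / 2\<close> is replaced by jumps of size \<open>\<delta>\<close>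
  at rate \<open>\<sigma>\<^sup>2 / \<delta>\<^sup>2\<close>. What remains is a linear term minus an integral of \<open>1 - e\<^sup>-\<^sup>u\<^sup>z\<close> against a
  finite measure.\<close>

definition truncated_mechanism :: "real \<Rightarrow> real \<Rightarrow> real" where
  "truncated_mechanism \<delta> z = b * z + \<sigma>\<^sup>2 * (compensated_exp (z * \<delta>) / \<delta>\<^sup>2)
     + (\<integral>u. indicator {\<delta><..} u * compensated_exp (z * u) \<partial>m)"

text \<open>The coefficient of \<open>z\<close> in the truncated mechanism after the compensators have been collected.\<close>

definition truncation_drift :: "real \<Rightarrow> real" where
  "truncation_drift \<delta> = b + \<sigma>\<^sup>2 / \<delta> + (\<integral>u. indicator {\<delta><..} u * u \<partial>m)"

text \<open>The map \<open>z \<mapsto> z - h \<phi>\<^sub>\<delta>(z)\<close> for the truncated mechanism \<open>\<phi>\<^sub>\<delta>\<close>, see \<open>euler_step_eq\<close>, arranged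
  so that it is visibly a Bernstein function when \<open>h * truncation_drift \<delta> \<le> 1\<close>.\<close>

definition euler_step :: "real \<Rightarrow> real \<Rightarrow> real \<Rightarrow> real" where
  "euler_step \<delta> h z = (1 - h * truncation_drift \<delta>) * z + h * (\<sigma>\<^sup>2 / \<delta>\<^sup>2 * (1 - exp (- \<delta> * z))
     + ((\<integral>u. indicator {\<delta><..} u \<partial>m) - (\<integral>u. indicator {\<delta><..} u * exp (- u * z) \<partial>m)))"

lemma integrable_tail:
  fixes f :: "real \<Rightarrow> real"
  assumes \<delta>: "0 < \<delta>" "\<delta> \<le> 1"
  shows "integrable m (\<lambda>u. indicator {\<delta><..} u * u)" "integrable m (indicator {\<delta><..} :: real \<Rightarrow> real)"
    and "f \<in> borel_measurable borel \<Longrightarrow> (\<And>u. 0 < u \<Longrightarrow> \<bar>f u\<bar> \<le> 1) \<Longrightarrow>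
      integrable m (\<lambda>u. indicator {\<delta><..} u * f u)"
proof -
  have main: "\<bar>indicator {\<delta><..} u * u\<bar> \<le> 1 / \<delta>\<^sup>2 * min u (u\<^sup>2)" if "0 < u" for u :: real
  proof (cases "\<delta> < u")
    case True
    have "\<delta>\<^sup>2 \<le> \<delta>" using \<delta> by (simp add: power2_eq_square mult_left_le)
    then have "\<delta>\<^sup>2 * u \<le> u" "\<delta>\<^sup>2 * u \<le> u * u"
      using \<delta> True by (auto intro!: mult_right_mono simp: mult_left_le_one_le)
    then show ?thesis using True that \<delta> by (simp add: min_def power2_eq_square field_simps)
  qed (use that in auto)
  have tail: "\<bar>indicator {\<delta><..} u\<bar> \<le> 1 / \<delta> ^ 3 * min u (u\<^sup>2)" if "0 < u" for u :: real
  proof -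
    have "\<bar>indicator {\<delta><..} u\<bar> \<le> 1 / \<delta> * \<bar>indicator {\<delta><..} u * u\<bar>"
      using \<delta> that by (auto simp: indicator_def field_simps)
    also have "\<dots> \<le> 1 / \<delta> * (1 / \<delta>\<^sup>2 * min u (u\<^sup>2))"
      using \<delta> main[OF that] by (intro mult_left_mono) auto
    finally show ?thesis by (simp add: power2_eq_square power3_eq_cube)
  qed
  show "integrable m (\<lambda>u. indicator {\<delta><..} u * u)"
    by (rule integrable_dominated[OF _ main]) simp_all
  show "integrable m (indicator {\<delta><..} :: real \<Rightarrow> real)"
    by (rule integrable_dominated[OF _ tail]) simp_all
  show "integrable m (\<lambda>u. indicator {\<delta><..} u * f u)"
    if "f \<in> borel_measurable borel" "\<And>u. 0 < u \<Longrightarrow> \<bar>f u\<bar> \<le> 1"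
  proof (rule integrable_dominated)
    fix u :: real assume u: "0 < u"
    have "\<bar>indicator {\<delta><..} u * f u\<bar> \<le> \<bar>indicator {\<delta><..} u\<bar> * 1"
      unfolding abs_mult using that(2)[OF u] by (intro mult_left_mono) auto
    then show "\<bar>indicator {\<delta><..} u * f u\<bar> \<le> 1 / \<delta> ^ 3 * min u (u\<^sup>2)" using tail[OF u] by simp
  qed (use that(1) in measurable)
qed

lemma integrable_truncated_jump:
  assumes "0 \<le> z" shows "integrable m (\<lambda>u. indicator {\<delta><..} u * compensated_exp (z * u))"
proof (rule Bochner_Integration.integrable_bound[OF integrable_jump[OF assms]])
  show "(\<lambda>u. indicator {\<delta><..} u * compensated_exp (z * u)) \<in> borel_measurable m"
    by (rule measurable_m) (use compensated_exp_measurable[of z] in measurable)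
qed (auto simp: indicator_def)

lemma euler_step_eq:
  assumes \<delta>: "0 < \<delta>" "\<delta> \<le> 1" and z: "0 \<le> z"
  shows "euler_step \<delta> h z = z - h * truncated_mechanism \<delta> z"
proof -
  have ie: "integrable m (\<lambda>u. indicator {\<delta><..} u * exp (- u * z))"
    using z by (intro integrable_tail(3)[OF \<delta>]) auto
  have "(\<integral>u. indicator {\<delta><..} u * compensated_exp (z * u) \<partial>m)
      = (\<integral>u. indicator {\<delta><..} u * exp (- u * z) - indicator {\<delta><..} u + z * (indicator {\<delta><..} u * u) \<partial>m)"
    by (rule Bochner_Integration.integral_cong) (auto simp: compensated_exp_def algebra_simps)
  also have "\<dots> = (\<integral>u. indicator {\<delta><..} u * exp (- u * z) \<partial>m) - (\<integral>u. indicator {\<delta><..} u \<partial>m)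
      + z * (\<integral>u. indicator {\<delta><..} u * u \<partial>m)"
    using ie integrable_tail(1,2)[OF \<delta>]
    by (simp add: Bochner_Integration.integral_add Bochner_Integration.integral_diff
        del: integral_indicator)
  finally have 1: "(\<integral>u. indicator {\<delta><..} u * compensated_exp (z * u) \<partial>m) = \<dots>" .
  have 2: "compensated_exp (z * \<delta>) / \<delta>\<^sup>2 = z / \<delta> - 1 / \<delta>\<^sup>2 * (1 - exp (- \<delta> * z))"
    using \<delta> by (simp add: compensated_exp_def field_simps power2_eq_square)
  show ?thesis
    unfolding euler_step_def truncated_mechanism_def truncation_drift_def 1 2
    by (simp add: algebra_simps del: integral_indicator)
qed

lemma truncated_mechanism_mono:
  assumes "0 \<le> z" "z \<le> y" "0 < \<delta>" shows "truncated_mechanism \<delta> z \<le> truncated_mechanism \<delta> y"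
  unfolding truncated_mechanism_def using assms b_pos
  by (intro add_mono mult_left_mono divide_right_mono integral_mono integrable_truncated_jump
      compensated_exp_mono mult_right_mono) (auto simp: space_m)

lemma euler_step_mono:
  assumes \<delta>: "0 < \<delta>" "\<delta> \<le> 1" and h: "0 \<le> h" "h * truncation_drift \<delta> \<le> 1" and z: "0 \<le> z" "z \<le> y"
  shows "euler_step \<delta> h z \<le> euler_step \<delta> h y"
proof -
  have i: "integrable m (\<lambda>u. indicator {\<delta><..} u * exp (- u * x))" if "0 \<le> x" for x
    using that by (intro integrable_tail(3)[OF \<delta>]) auto
  have "(\<integral>u. indicator {\<delta><..} u * exp (- u * y) \<partial>m) \<le> (\<integral>u. indicator {\<delta><..} u * exp (- u * z) \<partial>m)"
    using z by (intro integral_mono i mult_left_mono) (auto simp: space_m)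
  then show ?thesis
    unfolding euler_step_def using assms by (intro add_mono mult_left_mono diff_mono) auto
qed

lemma euler_step_0: "0 < \<delta> \<Longrightarrow> \<delta> \<le> 1 \<Longrightarrow> euler_step \<delta> h 0 = 0"
  by (simp add: euler_step_eq truncated_mechanism_def)

lemma euler_step_nonneg:
  assumes "0 < \<delta>" "\<delta> \<le> 1" "0 \<le> h" "h * truncation_drift \<delta> \<le> 1" "0 \<le> z"
  shows "0 \<le> euler_step \<delta> h z"
  using euler_step_mono[OF assms(1-4) order_refl assms(5)] euler_step_0[OF assms(1,2)] by simp

text \<open>Both the step and its distance to the identity are non-decreasing, hence increments of the step lie between \<open>0\<close>
  and the increments of the identity.\<close>

lemma euler_step_contraction:
  assumes \<delta>: "0 < \<delta>" "\<delta> \<le> 1" and h: "0 \<le> h" "h * truncation_drift \<delta> \<le> 1" and "0 \<le> y" "0 \<le> z"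
  shows "\<bar>euler_step \<delta> h y - euler_step \<delta> h z\<bar> \<le> \<bar>y - z\<bar>"
proof -
  have *: "\<bar>euler_step \<delta> h y - euler_step \<delta> h z\<bar> \<le> \<bar>y - z\<bar>" if "0 \<le> z" "z \<le> y" for y z
  proof -
    have "0 \<le> h * (truncated_mechanism \<delta> y - truncated_mechanism \<delta> z)"
      using truncated_mechanism_mono[OF that \<delta>(1)] h by simp
    then show ?thesis
      using euler_step_mono[OF \<delta> h that] that by (simp add: euler_step_eq[OF \<delta>] algebra_simps)
  qed
  show ?thesis
    using *[of y z] *[of z y] assms by (cases "z \<le> y") (auto simp: abs_minus_commute)
qed

lemma euler_step_bernstein:
  assumes \<delta>: "0 < \<delta>" "\<delta> \<le> 1" and h: "0 \<le> h" "h * truncation_drift \<delta> \<le> 1" and f: "bernstein_seq f"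
  shows "bernstein_seq (\<lambda>n. euler_step \<delta> h (f n))"
  unfolding euler_step_def
proof (intro bernstein_seq_add bernstein_seq_cmult bernstein_seq_const_minus f)
  have ie: "integrable m (\<lambda>u. indicator {\<delta><..} u * exp (- u * f n))" for n
    using bernstein_seq_nonneg[OF f, of n] by (intro integrable_tail(3)[OF \<delta>]) auto
  show "completely_monotone (\<lambda>n. \<integral>u. indicator {\<delta><..} u * exp (- u * f n) \<partial>m)"
    using ie by (intro completely_monotone_integral completely_monotone_cmult bernstein_seq_exp f)
      (auto simp: space_m)
  show "(\<integral>u. indicator {\<delta><..} u * exp (- u * f n) \<partial>m) \<le> (\<integral>u. indicator {\<delta><..} u \<partial>m)" for n
    using bernstein_seq_nonneg[OF f, of n]
    by (intro integral_mono ie integrable_tail(2)[OF \<delta>]) (auto simp: space_m indicator_def)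
  show "completely_monotone (\<lambda>n. exp (- \<delta> * f n))"
    using \<delta> by (intro bernstein_seq_exp f) auto
qed (use assms bernstein_seq_nonneg[OF f] in auto)

definition truncation_error :: "real \<Rightarrow> real \<Rightarrow> real" where
  "truncation_error c \<delta> = \<sigma>\<^sup>2 * c ^ 3 * \<delta> + c\<^sup>2 * (\<integral>u. indicator {..\<delta>} u * u\<^sup>2 \<partial>m)"

lemma integrable_small_square:
  assumes "\<delta> \<le> 1" shows "integrable m (\<lambda>u. indicator {..\<delta>} u * u\<^sup>2)"
proof (rule integrable_dominated)
  show "\<bar>indicator {..\<delta>} u * u\<^sup>2\<bar> \<le> 1 * min u (u\<^sup>2)" if "0 < u" for u
    using that assms by (auto simp: indicator_def power2_eq_square mult_left_le)
qed simp

text \<open>Uniformly on \<open>[0, c]\<close>, the dropped jumps contribute at most \<open>c\<^sup>2 \<integral>\<^sub>u\<^sub>\<le>\<^sub>\<delta> u\<^sup>2 m(du)\<close>, and the replacement of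
  the diffusion costs a third-order Taylor remainder.\<close>

lemma truncated_mechanism_close:
  assumes \<delta>: "0 < \<delta>" "\<delta> \<le> 1" and z: "0 \<le> z" "z \<le> c"
  shows "\<bar>\<phi> z - truncated_mechanism \<delta> z\<bar> \<le> truncation_error c \<delta>"
proof -
  have i: "integrable m (\<lambda>u. indicator {..\<delta>} u * compensated_exp (z * u))"
  proof (rule Bochner_Integration.integrable_bound[OF integrable_jump[OF z(1)]])
    show "(\<lambda>u. indicator {..\<delta>} u * compensated_exp (z * u)) \<in> borel_measurable m"
      by (rule measurable_m) (use compensated_exp_measurable[of z] in measurable)
  qed (auto simp: indicator_def)
  have "(\<integral>u. compensated_exp (z * u) \<partial>m)
      = (\<integral>u. indicator {\<delta><..} u * compensated_exp (z * u) + indicator {..\<delta>} u * compensated_exp (z * u) \<partial>m)"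
    by (rule Bochner_Integration.integral_cong) (auto simp: indicator_def)
  also have "\<dots> = (\<integral>u. indicator {\<delta><..} u * compensated_exp (z * u) \<partial>m)
      + (\<integral>u. indicator {..\<delta>} u * compensated_exp (z * u) \<partial>m)"
    by (rule Bochner_Integration.integral_add[OF integrable_truncated_jump[OF z(1)] i])
  finally have split: "\<phi> z - truncated_mechanism \<delta> z
      = \<sigma>\<^sup>2 * (z\<^sup>2 / 2 - compensated_exp (z * \<delta>) / \<delta>\<^sup>2)
        + (\<integral>u. indicator {..\<delta>} u * compensated_exp (z * u) \<partial>m)"
    by (simp add: phi_eq truncated_mechanism_def algebra_simps)
  have zc: "z\<^sup>2 \<le> c\<^sup>2" "z ^ 3 \<le> c ^ 3" using z by (auto intro: power_mono)
  have "z\<^sup>2 / 2 - compensated_exp (z * \<delta>) / \<delta>\<^sup>2 \<le> z ^ 3 * \<delta>"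
    using compensated_exp_ge[of "z * \<delta>"] z \<delta>
    by (simp add: field_simps power2_eq_square power3_eq_cube)
  also have "\<dots> \<le> c ^ 3 * \<delta>" using zc \<delta> by (intro mult_right_mono) auto
  finally have "\<sigma>\<^sup>2 * (z\<^sup>2 / 2 - compensated_exp (z * \<delta>) / \<delta>\<^sup>2) \<le> \<sigma>\<^sup>2 * (c ^ 3 * \<delta>)"
    by (intro mult_left_mono) auto
  moreover have "0 \<le> z\<^sup>2 / 2 - compensated_exp (z * \<delta>) / \<delta>\<^sup>2"
    using compensated_exp_le[of "z * \<delta>"] z \<delta> by (simp add: field_simps power2_eq_square)
  then have "0 \<le> \<sigma>\<^sup>2 * (z\<^sup>2 / 2 - compensated_exp (z * \<delta>) / \<delta>\<^sup>2)" by simp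
  moreover have "0 \<le> (\<integral>u. indicator {..\<delta>} u * compensated_exp (z * u) \<partial>m)"
    using z by (intro Bochner_Integration.integral_nonneg mult_nonneg_nonneg compensated_exp_nonneg) (auto simp: space_m)
  moreover have "(\<integral>u. indicator {..\<delta>} u * compensated_exp (z * u) \<partial>m) \<le> (\<integral>u. c\<^sup>2 * (indicator {..\<delta>} u * u\<^sup>2) \<partial>m)"
  proof (intro integral_mono i integrable_mult_right integrable_small_square \<delta>)
    fix u assume "u \<in> space m"
    then have u: "0 < u" by (simp add: space_m)
    have "compensated_exp (z * u) \<le> (z * u)\<^sup>2 / 2" using z u by (intro compensated_exp_le) auto
    also have "\<dots> \<le> z\<^sup>2 * u\<^sup>2" by (simp add: power_mult_distrib)
    also have "\<dots> \<le> c\<^sup>2 * u\<^sup>2" using zc by (intro mult_right_mono) auto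
    finally show "indicator {..\<delta>} u * compensated_exp (z * u) \<le> c\<^sup>2 * (indicator {..\<delta>} u * u\<^sup>2)"
      by (simp add: indicator_def)
  qed
  ultimately show ?thesis unfolding split truncation_error_def by simp
qed

lemma truncation_error_tendsto: "(\<lambda>j. truncation_error c (1 / real (Suc j))) \<longlonglongrightarrow> 0"
proof -
  have "(\<lambda>j. \<integral>u. indicator {..1 / real (Suc j)} u * u\<^sup>2 \<partial>m) \<longlonglongrightarrow> (\<integral>u. 0 \<partial>m)"
  proof (rule integral_dominated_convergence[where w="\<lambda>u. min u (u\<^sup>2)"])
    show "AE u in m. (\<lambda>j. indicator {..1 / real (Suc j)} u * u\<^sup>2) \<longlonglongrightarrow> 0"
    proof (rule AE_I2)
      fix u assume "u \<in> space m"
      then have u: "0 < u" by (simp add: space_m)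
      obtain N where N: "1 / real (Suc N) < u" using nat_approx_posE[OF u] by blast
      have "\<forall>\<^sub>F j in sequentially. indicator {..1 / real (Suc j)} u * u\<^sup>2 = 0"
        unfolding eventually_sequentially
      proof (intro exI[of _ N] allI impI)
        fix j assume "N \<le> j"
        then have "1 / real (Suc j) \<le> 1 / real (Suc N)" by (intro divide_left_mono) auto
        then show "indicator {..1 / real (Suc j)} u * u\<^sup>2 = 0" using N by simp
      qed
      then show "(\<lambda>j. indicator {..1 / real (Suc j)} u * u\<^sup>2) \<longlonglongrightarrow> 0" by (rule tendsto_eventually)
    qed
    show "AE u in m. norm (indicator {..1 / real (Suc j)} u * u\<^sup>2) \<le> min u (u\<^sup>2)" for j
    proof (rule AE_I2)
      fix u assume "u \<in> space m"
      then have u: "0 < u" by (simp add: space_m)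
      have "1 / real (Suc j) \<le> 1" by simp
      then have "u \<le> 1" if "u \<le> 1 / real (Suc j)" using that by linarith
      then show "norm (indicator {..1 / real (Suc j)} u * u\<^sup>2) \<le> min u (u\<^sup>2)"
        using u by (auto simp: indicator_def power2_eq_square mult_left_le)
    qed
  qed (auto intro!: measurable_m integrable_min)
  moreover have "(\<lambda>j. 1 / real (Suc j)) \<longlonglongrightarrow> 0" using LIMSEQ_inverse_real_of_nat by (simp add: inverse_eq_divide)
  ultimately have "(\<lambda>j. \<sigma>\<^sup>2 * c ^ 3 * (1 / real (Suc j)) + c\<^sup>2 * (\<integral>u. indicator {..1 / real (Suc j)} u * u\<^sup>2 \<partial>m))
      \<longlonglongrightarrow> \<sigma>\<^sup>2 * c ^ 3 * 0 + c\<^sup>2 * (\<integral>u. 0 \<partial>m)"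
    by (intro tendsto_intros) auto
  then show ?thesis unfolding truncation_error_def by simp
qed

end

section \<open>The cumulant flow\<close>

locale subcritical_flow = subcritical_mechanism +
  fixes v :: "real \<Rightarrow> real \<Rightarrow> real"
  assumes flow: "cumulant_flow (branching_mechanism b \<sigma> m) v"
begin

lemma v_0: "0 \<le> z \<Longrightarrow> v 0 z = z"
  and v_nonneg: "0 \<le> z \<Longrightarrow> 0 \<le> t \<Longrightarrow> 0 \<le> v t z"
  and v_deriv: "0 \<le> z \<Longrightarrow> 0 \<le> t \<Longrightarrow>
    ((\<lambda>s. v s z) has_real_derivative - \<phi> (v t z)) (at t within {0..})"
  using flow by (auto simp: cumulant_flow_def)

lemma v_mvt:
  assumes "0 \<le> z" "0 \<le> s" "s < t"
  obtains r where "s < r" "r < t" "v t z - v s z = - \<phi> (v r z) * (t - s)"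
proof -
  have "\<exists>r\<in>{s<..<t}. v t z - v s z = (\<lambda>x. - \<phi> (v r z) * x) (t - s)"
  proof (rule mvt_simple[OF assms(3)])
    fix x assume "s \<le> x" "x \<le> t"
    then have "((\<lambda>s. v s z) has_real_derivative - \<phi> (v x z)) (at x within {s..t})"
      using assms by (intro DERIV_subset[OF v_deriv]) auto
    then show "((\<lambda>s. v s z) has_derivative (\<lambda>y. - \<phi> (v x z) * y)) (at x within {s..t})"
      unfolding has_field_derivative_def .
  qed
  then show ?thesis using that by auto
qed

lemma v_antimono:
  assumes "0 \<le> z" "0 \<le> s" "s \<le> t" shows "v t z \<le> v s z"
proof (cases "s = t")
  case False
  then have "s < t" using assms by simp
  from v_mvt[OF assms(1,2) this] obtain r where r: "s < r" "v t z - v s z = - \<phi> (v r z) * (t - s)" by blast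
  then have "0 \<le> \<phi> (v r z) * (t - s)" using assms by (intro mult_nonneg_nonneg phi_nonneg v_nonneg) auto
  then show ?thesis using r by simp
qed simp

lemma v_le: "0 \<le> z \<Longrightarrow> 0 \<le> t \<Longrightarrow> v t z \<le> z"
  using v_antimono[of z 0 t] v_0[of z] by simp

lemma v_lipschitz:
  assumes "0 \<le> z" "0 \<le> s" "s \<le> t" shows "\<bar>v t z - v s z\<bar> \<le> \<phi> z * (t - s)"
proof (cases "s = t")
  case False
  then have "s < t" using assms by simp
  from v_mvt[OF assms(1,2) this] obtain r where r: "s < r" "v t z - v s z = - \<phi> (v r z) * (t - s)" by blast
  then have "\<phi> (v r z) * (t - s) \<le> \<phi> z * (t - s)"
    using assms by (intro mult_right_mono phi_mono v_nonneg v_le) auto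
  then show ?thesis using r v_antimono[OF assms] by simp
qed simp

text \<open>The local error has two parts: the truncation of \<open>\<phi>\<close>, and the variation of \<open>\<phi>(v)\<close> over a time step.\<close>

lemma euler_step_consistent:
  assumes \<delta>: "0 < \<delta>" "\<delta> \<le> 1" and h: "0 < h" and s: "0 \<le> s" and z: "0 \<le> z"
  shows "\<bar>v (s + h) z - euler_step \<delta> h (v s z)\<bar> \<le> h * (truncation_error z \<delta> + lipschitz_bound z * (\<phi> z * h))"
proof -
  obtain r where r: "s < r" "r < s + h" "v (s + h) z - v s z = - \<phi> (v r z) * (s + h - s)"
    using v_mvt[OF z s, of "s + h"] h by auto
  have vs: "v s z \<in> {0..z}" "v r z \<in> {0..z}" using z s r v_nonneg v_le by auto
  have "\<bar>\<phi> (v s z) - \<phi> (v r z)\<bar> \<le> lipschitz_bound z * \<bar>v s z - v r z\<bar>"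
    by (rule phi_abs_diff_le[OF vs(2,1)])
  also have "\<dots> \<le> lipschitz_bound z * (\<phi> z * h)"
  proof (rule mult_left_mono[OF _ lipschitz_bound_nonneg[OF z]])
    have "\<bar>v s z - v r z\<bar> \<le> \<phi> z * (r - s)"
      using v_lipschitz[OF z s, of r] r by (simp add: abs_minus_commute)
    also have "\<dots> \<le> \<phi> z * h" using r phi_nonneg[OF z] by (intro mult_left_mono) auto
    finally show "\<bar>v s z - v r z\<bar> \<le> \<phi> z * h" .
  qed
  finally have 1: "\<bar>\<phi> (v s z) - \<phi> (v r z)\<bar> \<le> lipschitz_bound z * (\<phi> z * h)" .
  have 2: "\<bar>\<phi> (v s z) - truncated_mechanism \<delta> (v s z)\<bar> \<le> truncation_error z \<delta>"
    using vs by (intro truncated_mechanism_close \<delta>) auto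
  have "v (s + h) z - euler_step \<delta> h (v s z) = h * (truncated_mechanism \<delta> (v s z) - \<phi> (v r z))"
    using r(3) vs euler_step_eq[OF \<delta>, of "v s z" h] by (simp add: algebra_simps)
  also have "\<bar>\<dots>\<bar> = h * \<bar>truncated_mechanism \<delta> (v s z) - \<phi> (v r z)\<bar>" using h by (simp add: abs_mult)
  also have "\<dots> \<le> h * (truncation_error z \<delta> + lipschitz_bound z * (\<phi> z * h))"
    using 1 2 h by (intro mult_left_mono) auto
  finally show ?thesis .
qed

text \<open>The analytic core: \<open>e\<^sup>-\<^sup>x\<^sup>v\<close> is a limit of the corresponding expressions for Euler iterates, which are
  Bernstein sequences because the scheme starts from the identity. The truncation level \<open>1 / (j + 1)\<close> tends to
  zero, and the number of steps grows fast enough for the step condition \<open>h * truncation_drift \<delta> \<le> 1\<close>.\<close>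

lemma completely_monotone_exp_v:
  assumes t: "0 \<le> t" and x: "0 \<le> x"
  shows "completely_monotone (\<lambda>n. exp (- x * v t (real n)))"
proof (cases "t = 0")
  case True
  then show ?thesis using bernstein_seq_exp[OF bernstein_seq_real x] by (simp add: v_0)
next
  case False
  define \<delta> where "\<delta> j = 1 / real (Suc j)" for j
  \<comment> \<open>The first summand ensures the step condition, the second makes the step size vanish.\<close>
  define k where "k j = nat \<lceil>t * truncation_drift (\<delta> j)\<rceil> + Suc j" for j
  define h where "h j = t / real (k j)" for j
  have \<delta>: "0 < \<delta> j" "\<delta> j \<le> 1" for j by (auto simp: \<delta>_def)
  have kpos: "0 < k j" for j by (simp add: k_def)
  have hk: "real (k j) * h j = t" for j using kpos[of j] by (simp add: h_def)
  have h0: "0 < h j" for j using kpos[of j] t False by (simp add: h_def)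
  have hc: "h j * truncation_drift (\<delta> j) \<le> 1" for j
  proof -
    have "t * truncation_drift (\<delta> j) \<le> real (k j)" unfolding k_def by linarith
    then show ?thesis using kpos[of j] by (simp add: h_def)
  qed
  have hlim: "h \<longlonglongrightarrow> 0"
  proof (rule tendsto_sandwich[of "\<lambda>_. 0"])
    show "\<forall>\<^sub>F j in sequentially. h j \<le> t * \<delta> j"
      using t by (intro always_eventually allI) (auto simp: h_def \<delta>_def k_def intro!: divide_left_mono)
    have "(\<lambda>j. t * \<delta> j) \<longlonglongrightarrow> t * 0" unfolding \<delta>_def
      using LIMSEQ_inverse_real_of_nat by (intro tendsto_mult_left) (simp add: inverse_eq_divide)
    then show "(\<lambda>j. t * \<delta> j) \<longlonglongrightarrow> 0" by simp
  qed (use h0 in \<open>auto intro!: always_eventually less_imp_le\<close>)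
  define f where "f j n = (euler_step (\<delta> j) (h j) ^^ k j) (real n)" for j n
  have "bernstein_seq (\<lambda>n. (euler_step (\<delta> j) (h j) ^^ i) (real n))" for i j
    by (induction i) (use bernstein_seq_real in \<open>auto intro!: euler_step_bernstein \<delta> hc less_imp_le[OF h0]\<close>)
  then have fB: "bernstein_seq (f j)" for j by (simp add: f_def[abs_def])
  have close: "\<bar>v t (real n) - f j n\<bar>
      \<le> t * (truncation_error (real n) (\<delta> j) + lipschitz_bound (real n) * (\<phi> (real n) * h j))" for j n
  proof -
    define w where "w i = v (real i * h j) (real n)" for i
    have "\<bar>w (k j) - (euler_step (\<delta> j) (h j) ^^ k j) (w 0)\<bar>
        \<le> real (k j) * (h j * (truncation_error (real n) (\<delta> j) + lipschitz_bound (real n) * (\<phi> (real n) * h j)))"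
    proof (rule contraction_iterates_close)
      fix i
      have "real (Suc i) * h j = real i * h j + h j" by (simp add: algebra_simps)
      then show "\<bar>w (Suc i) - euler_step (\<delta> j) (h j) (w i)\<bar>
          \<le> h j * (truncation_error (real n) (\<delta> j) + lipschitz_bound (real n) * (\<phi> (real n) * h j))"
        unfolding w_def using h0[of j] by (simp only:, intro euler_step_consistent \<delta>) auto
      show "0 \<le> w i" unfolding w_def using h0[of j] by (intro v_nonneg) auto
    qed (use \<delta> hc less_imp_le[OF h0] in \<open>auto intro!: euler_step_contraction euler_step_nonneg\<close>)
    then show ?thesis unfolding w_def f_def using hk[of j] by (simp add: v_0 mult.assoc[symmetric])
  qed
  have flim: "(\<lambda>j. f j n) \<longlonglongrightarrow> v t (real n)" for n
  proof -
    have "(\<lambda>j. t * (truncation_error (real n) (\<delta> j) + lipschitz_bound (real n) * (\<phi> (real n) * h j)))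
        \<longlonglongrightarrow> t * (0 + lipschitz_bound (real n) * (\<phi> (real n) * 0))"
      using truncation_error_tendsto[of "real n"] hlim unfolding \<delta>_def by (intro tendsto_intros)
    then have "(\<lambda>j. t * (truncation_error (real n) (\<delta> j) + lipschitz_bound (real n) * (\<phi> (real n) * h j))) \<longlonglongrightarrow> 0"
      by simp
    then have "(\<lambda>j. v t (real n) - f j n) \<longlonglongrightarrow> 0"
      by (rule Lim_null_comparison[rotated]) (use close in auto)
    then have "(\<lambda>j. v t (real n) - (v t (real n) - f j n)) \<longlonglongrightarrow> v t (real n) - 0"
      by (intro tendsto_diff tendsto_const)
    then show ?thesis by simp
  qed
  show ?thesis
  proof (rule completely_monotone_lim)
    show "completely_monotone (\<lambda>n. exp (- x * f j n))" for j
      by (rule bernstein_seq_exp[OF fB x])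
    show "(\<lambda>j. exp (- x * f j n)) \<longlonglongrightarrow> exp (- x * v t (real n))" for n
      by (intro tendsto_intros flim)
  qed
qed

text \<open>The function \<open>e\<^sup>b\<^sup>t v\<^sub>t\<close> is non-increasing because \<open>\<phi>(z) \<ge> b z\<close>.\<close>

lemma v_decay:
  assumes z: "0 \<le> z" and s: "0 \<le> s" and t: "0 \<le> t"
  shows "v (s + t) z \<le> exp (- b * t) * v s z"
proof (cases "t = 0")
  case False
  then have "s < s + t" using t by simp
  then have "\<exists>r\<in>{s<..<s + t}. v (s + t) z * exp (b * (s + t)) - v s z * exp (b * s)
      = (\<lambda>y. (- \<phi> (v r z) * exp (b * r) + (exp (b * r) * b) * v r z) * y) (s + t - s)"
  proof (rule mvt_simple)
    fix x assume "s \<le> x" "x \<le> s + t"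
    then have "((\<lambda>s. v s z) has_real_derivative - \<phi> (v x z)) (at x within {s..s + t})"
      using s z by (intro DERIV_subset[OF v_deriv]) auto
    moreover have "((\<lambda>s. exp (b * s)) has_real_derivative exp (b * x) * b) (at x within {s..s + t})"
      by (auto intro!: derivative_eq_intros)
    ultimately have "((\<lambda>s. v s z * exp (b * s)) has_real_derivative
        - \<phi> (v x z) * exp (b * x) + (exp (b * x) * b) * v x z) (at x within {s..s + t})"
      by (rule DERIV_mult)
    then show "((\<lambda>s. v s z * exp (b * s)) has_derivative
        (\<lambda>y. (- \<phi> (v x z) * exp (b * x) + (exp (b * x) * b) * v x z) * y)) (at x within {s..s + t})"
      unfolding has_field_derivative_def .
  qed
  then obtain r where r: "s < r" "v (s + t) z * exp (b * (s + t)) - v s z * exp (b * s)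
      = exp (b * r) * (b * v r z - \<phi> (v r z)) * t"
    by (auto simp: algebra_simps)
  have "exp (b * r) * (b * v r z - \<phi> (v r z)) * t \<le> 0"
    using phi_ge[of "v r z"] v_nonneg[OF z, of r] r s t
    by (intro mult_nonpos_nonneg mult_nonneg_nonpos) auto
  then have "v (s + t) z * exp (b * (s + t)) \<le> v s z * exp (b * s)" using r by simp
  then have "v (s + t) z * exp (b * (s + t)) * exp (- b * (s + t)) \<le> v s z * exp (b * s) * exp (- b * (s + t))"
    by (rule mult_right_mono) simp
  then show ?thesis by (simp add: exp_add[symmetric] mult.assoc algebra_simps)
qed simp

lemma v_le_exp: "0 \<le> z \<Longrightarrow> 0 \<le> t \<Longrightarrow> v t z \<le> z * exp (- b * t)"
  using v_decay[of z 0 t] by (simp add: v_0 mult.commute)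

text \<open>Coming down from infinity: as long as \<open>v\<close> stays above \<open>\<theta>\<close>, a primitive \<open>G\<close> of \<open>1/\<phi>\<close> decreases
  along the flow at unit speed, so this lasts at most \<open>\<integral>\<^sub>\<theta>\<^sup>\<infinity> dz/\<phi>(z)\<close>, whatever the starting point.\<close>

lemma v_descends_below:
  assumes \<theta>: "0 < \<theta>" and grey: "(\<integral>\<^sup>+z\<in>{\<theta><..}. ennreal (1 / \<phi> z) \<partial>lborel) < \<infinity>"
  obtains T where "0 \<le> T" and "\<And>t z. T \<le> t \<Longrightarrow> 0 \<le> z \<Longrightarrow> v t z \<le> \<theta>"
proof
  define I where "I = enn2real (\<integral>\<^sup>+z\<in>{\<theta><..}. ennreal (1 / \<phi> z) \<partial>lborel)"
  show "0 \<le> I + 1" by (simp add: I_def)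
  fix t z :: real assume t: "I + 1 \<le> t" and z: "0 \<le> z"
  have "0 \<le> I" unfolding I_def by (rule enn2real_nonneg)
  then have t0: "0 < t" using t by linarith
  show "v t z \<le> \<theta>"
  proof (rule ccontr)
    assume "\<not> v t z \<le> \<theta>"
    then have above: "\<theta> < v t z" by simp
    have \<phi>pos: "0 < \<phi> y" if "\<theta> \<le> y" for y
      using phi_ge[of y] that \<theta> b_pos mult_pos_pos[of b y] by linarith
    \<comment> \<open>Freezing \<open>\<phi>\<close> below \<open>\<theta>\<close> makes the integrand continuous on the whole line.\<close>
    define g where "g y = 1 / \<phi> (max \<theta> y)" for y
    have "continuous_on UNIV (\<lambda>y. \<phi> (max \<theta> y))"
      by (rule continuous_on_compose2[OF phi_continuous]) (use \<theta> in \<open>auto intro!: continuous_intros\<close>)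
    then have gc: "continuous_on UNIV g" unfolding g_def
      by (intro continuous_on_divide continuous_on_const) (use \<phi>pos[OF max.cobounded1] in \<open>auto simp: less_imp_neq[symmetric]\<close>)
    have g0: "0 \<le> g y" for y using \<phi>pos[of "max \<theta> y"] by (simp add: g_def)
    define G where "G x = integral {\<theta>..x} g" for x
    have Gd: "(G has_real_derivative g x) (at x)" if "\<theta> < x" for x
    proof -
      have "(G has_real_derivative g x) (at x within {\<theta>..x + 1})" unfolding G_def
        by (rule integral_has_real_derivative) (use that gc continuous_on_subset in auto)
      then show ?thesis using that by (simp add: at_within_Icc_at)
    qed
    have "\<exists>r\<in>{0<..<t}. G (v t z) - G (v 0 z) = (\<lambda>y. (- 1) * y) (t - 0)"
    proof (rule mvt_simple[OF t0])
      fix s assume s: "0 \<le> s" "s \<le> t"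
      then have "\<theta> < v s z" using v_antimono[OF z, of s t] above by simp
      have "((\<lambda>s. v s z) has_real_derivative - \<phi> (v s z)) (at s within {0..t})"
        using s z by (intro DERIV_subset[OF v_deriv]) auto
      from DERIV_chain2[OF Gd[OF \<open>\<theta> < v s z\<close>] this]
      have "((\<lambda>s. G (v s z)) has_real_derivative - 1) (at s within {0..t})"
        using \<open>\<theta> < v s z\<close> \<phi>pos[of "v s z"] by (simp add: g_def max_def)
      then show "((\<lambda>s. G (v s z)) has_derivative (\<lambda>y. (- 1) * y)) (at s within {0..t})"
        unfolding has_field_derivative_def .
    qed
    then have diff: "G z - G (v t z) = t" using z by (auto simp: v_0)
    have vz: "v t z \<le> z" using v_le[OF z] t0 by simp
    have "ennreal (G z - G (v t z)) = (\<integral>\<^sup>+x. ennreal (g x) * indicator {v t z..z} x \<partial>lborel)"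
      by (rule nn_integral_FTC_Icc[symmetric])
        (use vz g0 above Gd gc in \<open>auto intro: borel_measurable_continuous_onI less_le_trans\<close>)
    also have "\<dots> \<le> (\<integral>\<^sup>+z\<in>{\<theta><..}. ennreal (1 / \<phi> z) \<partial>lborel)"
      by (rule nn_integral_mono) (use above in \<open>auto simp: g_def indicator_def max_def\<close>)
    also have "\<dots> = ennreal I" using grey by (simp add: I_def)
    finally have "t \<le> I" using diff t0 by (simp add: I_def)
    then show False using t by simp
  qed
qed

lemma v_continuous: "0 \<le> z \<Longrightarrow> continuous_on {0..} (\<lambda>s. v s z)"
  unfolding continuous_on_eq_continuous_within
  by (auto intro: DERIV_continuous v_deriv)

text \<open>Integrating \<open>b v \<le> \<phi>(v) = - v'\<close> in time.\<close>

lemma integral_v_le: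
  assumes z: "0 \<le> z" and t: "0 \<le> t"
  shows "integral {0..t} (\<lambda>s. v s z) \<le> z / b"
proof -
  have "((\<lambda>s. - \<phi> (v s z)) has_integral v t z - v 0 z) {0..t}"
  proof (rule fundamental_theorem_of_calculus[OF t])
    fix x assume "x \<in> {0..t}"
    then have "((\<lambda>s. v s z) has_real_derivative - \<phi> (v x z)) (at x within {0..t})"
      using z by (intro DERIV_subset[OF v_deriv]) auto
    then show "((\<lambda>s. v s z) has_vector_derivative - \<phi> (v x z)) (at x within {0..t})"
      by (simp add: has_real_derivative_iff_has_vector_derivative)
  qed
  from has_integral_mult_right[OF this, of "- 1 / b"]
  have I: "((\<lambda>s. \<phi> (v s z) / b) has_integral (z - v t z) / b) {0..t}"
    using z by (simp add: v_0 diff_divide_distrib)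
  have "integral {0..t} (\<lambda>s. v s z) \<le> integral {0..t} (\<lambda>s. \<phi> (v s z) / b)"
  proof (rule integral_le)
    show "(\<lambda>s. v s z) integrable_on {0..t}"
      by (intro integrable_continuous_interval continuous_on_subset[OF v_continuous[OF z]]) auto
    show "(\<lambda>s. \<phi> (v s z) / b) integrable_on {0..t}" using I by blast
    show "v s z \<le> \<phi> (v s z) / b" if "s \<in> {0..t}" for s
      using phi_ge[OF v_nonneg[OF z, of s]] that b_pos by (simp add: field_simps)
  qed
  also have "\<dots> = (z - v t z) / b" using I by (rule integral_unique)
  also have "\<dots> \<le> z / b" using v_nonneg[OF z t] b_pos by (intro divide_right_mono) auto
  finally show ?thesis .
qed

end

section \<open>Comparison of transition laws\<close>

locale subcritical_cbi = subcritical_flow +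
  fixes a :: real and P :: "real \<Rightarrow> real \<Rightarrow> real measure"
  assumes a_nonneg: "0 \<le> a" and cbi: "cbi_semigroup v a P"
begin

lemma space_Rplus: "space Rplus = {0..}"
  by (simp add: Rplus_def)

lemma kernel: "0 \<le> t \<Longrightarrow> P t \<in> Rplus \<rightarrow>\<^sub>M prob_algebra Rplus"
  using cbi by (simp add: cbi_semigroup_def transition_semigroup_def)

lemma prob_space_P: "0 \<le> t \<Longrightarrow> 0 \<le> x \<Longrightarrow> prob_space (P t x)"
  and sets_P: "0 \<le> t \<Longrightarrow> 0 \<le> x \<Longrightarrow> sets (P t x) = sets Rplus"
  using measurable_space[OF kernel, of t x] by (simp_all add: space_prob_algebra space_Rplus)

lemma laplace_P:
  "0 \<le> t \<Longrightarrow> 0 \<le> x \<Longrightarrow> 0 \<le> z \<Longrightarrow>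
    (\<integral>y. exp (- z * y) \<partial>P t x) = exp (- x * v t z - a * integral {0..t} (\<lambda>s. v s z))"
  using cbi by (simp add: cbi_semigroup_def)

lemma measurable_Rplus: "f \<in> borel_measurable borel \<Longrightarrow> f \<in> borel_measurable Rplus"
  unfolding Rplus_def by (rule measurable_restrict_space1)

lemma integrable_laplace:
  assumes N: "prob_space N" "sets N = sets Rplus" and z: "0 \<le> z"
  shows "integrable N (\<lambda>x. exp (- z * x))"
proof -
  interpret prob_space N by fact
  show ?thesis
  proof (rule integrable_const_bound[where B=1])
    show "AE x in N. norm (exp (- z * x)) \<le> 1"
    proof (rule AE_I2)
      fix x assume "x \<in> space N"
      then have "0 \<le> x" using sets_eq_imp_space_eq[OF N(2)] by (simp add: space_Rplus)
      then show "norm (exp (- z * x)) \<le> 1" using z by simp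
    qed
    show "(\<lambda>x. exp (- z * x)) \<in> borel_measurable N"
      unfolding measurable_cong_sets[OF N(2) refl] by (rule measurable_Rplus) simp
  qed
qed

text \<open>The difference of the two sides has Laplace transform
  \<open>exp (- A n) * (exp (- y * v t n) - exp (- y * w))\<close>, where \<open>exp (- A n)\<close> is the transform of \<open>P t 0\<close>.
  Both factors are completely monotone; in the second one \<open>w\<close> being an upper bound of \<open>v t\<close> gives positivity.\<close>

lemma transition_dominates:
  assumes t: "0 \<le> t" and y: "0 \<le> y" and w: "\<And>z. 0 \<le> z \<Longrightarrow> v t z \<le> w"
  shows "density (P t 0) (\<lambda>_. ennreal (exp (- y * w))) \<le> P t y"
proof (rule measure_le_of_laplace)
  interpret P0: prob_space "P t 0" by (rule prob_space_P) (use t in auto)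
  interpret Py: prob_space "P t y" by (rule prob_space_P) (use t y in auto)
  show "finite_measure (density (P t 0) (\<lambda>_. ennreal (exp (- y * w))))"
    by (rule finite_measureI) (simp add: emeasure_density_const P0.emeasure_space_1)
  show "finite_measure (P t y)" by unfold_locales
  show "sets (density (P t 0) (\<lambda>_. ennreal (exp (- y * w)))) = sets Rplus" "sets (P t y) = sets Rplus"
    using t y by (simp_all add: sets_P)
  define A where "A n = a * integral {0..t} (\<lambda>s. v s (real n))" for n :: nat
  have em: "(\<lambda>x. exp (- real n * x)) \<in> borel_measurable (P t 0)" for n
    unfolding measurable_cong_sets[OF sets_P[OF t order_refl] refl] by (rule measurable_Rplus) simp
  have "completely_monotone (\<lambda>n. exp (- A n))"
    using completely_monotone_laplace[OF P0.finite_measure_axioms sets_P[OF t order_refl]]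
      laplace_P[OF t order_refl of_nat_0_le_iff]
    by (simp add: A_def del: mult_minus_left)
  moreover have "completely_monotone (\<lambda>n. exp (- y * v t (real n)) - exp (- y * w))"
    using completely_monotone_exp_v[OF t y] w y by (intro completely_monotone_diff_const) (auto intro: mult_left_mono)
  ultimately have "completely_monotone (\<lambda>n. exp (- A n) * (exp (- y * v t (real n)) - exp (- y * w)))"
    by (rule completely_monotone_mult)
  also have "(\<lambda>n. exp (- A n) * (exp (- y * v t (real n)) - exp (- y * w)))
      = (\<lambda>n. (\<integral>x. exp (- real n * x) \<partial>P t y)
        - (\<integral>x. exp (- real n * x) \<partial>density (P t 0) (\<lambda>_. ennreal (exp (- y * w)))))"
  proof (rule ext)
    fix n
    have "(\<integral>x. exp (- real n * x) \<partial>density (P t 0) (\<lambda>_. ennreal (exp (- y * w))))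
        = (\<integral>x. exp (- y * w) *\<^sub>R exp (- real n * x) \<partial>P t 0)"
      by (rule integral_density[OF em]) auto
    also have "\<dots> = exp (- y * w) * exp (- A n)"
      using laplace_P[OF t order_refl, of "real n"] by (simp add: A_def del: mult_minus_left)
    finally have N1: "(\<integral>x. exp (- real n * x) \<partial>density (P t 0) (\<lambda>_. ennreal (exp (- y * w))))
        = exp (- y * w) * exp (- A n)" .
    have N2: "(\<integral>x. exp (- real n * x) \<partial>P t y) = exp (- y * v t (real n)) * exp (- A n)"
      unfolding laplace_P[OF t y of_nat_0_le_iff] A_def by (simp add: exp_add[symmetric])
    show "exp (- A n) * (exp (- y * v t (real n)) - exp (- y * w))
        = (\<integral>x. exp (- real n * x) \<partial>P t y)
        - (\<integral>x. exp (- real n * x) \<partial>density (P t 0) (\<lambda>_. ennreal (exp (- y * w))))"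
      unfolding N1 N2 by (simp add: algebra_simps)
  qed
  finally show "completely_monotone (\<lambda>n. (\<integral>x. exp (- real n * x) \<partial>P t y)
        - (\<integral>x. exp (- real n * x) \<partial>density (P t 0) (\<lambda>_. ennreal (exp (- y * w)))))" .
qed

text \<open>Domination of the transition laws, applied to \<open>h\<close> and to \<open>1 - h\<close>, bounds the difference from both
  sides.\<close>

lemma transition_operator_close:
  fixes h :: "real \<Rightarrow> real"
  assumes t: "0 \<le> t" and y: "0 \<le> y" and w: "\<And>z. 0 \<le> z \<Longrightarrow> v t z \<le> w"
    and h: "h \<in> borel_measurable Rplus" "\<And>x. 0 \<le> x \<Longrightarrow> 0 \<le> h x" "\<And>x. 0 \<le> x \<Longrightarrow> h x \<le> 1"
  shows "\<bar>(\<integral>x. h x \<partial>P t y) - (\<integral>x. h x \<partial>P t 0)\<bar> \<le> 1 - exp (- y * w)"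
proof -
  interpret P0: prob_space "P t 0" by (rule prob_space_P) (use t in auto)
  interpret Py: prob_space "P t y" by (rule prob_space_P) (use t y in auto)
  have sp: "space (P t x) = {0..}" if "0 \<le> x" for x
    using sets_eq_imp_space_eq[OF sets_P[OF t that]] by (simp add: space_Rplus)
  have mP: "f \<in> borel_measurable (P t x)" if "0 \<le> x" "f \<in> borel_measurable Rplus" for f :: "real \<Rightarrow> real" and x
    using that by (simp add: measurable_cong_sets[OF sets_P[OF t] refl])
  have int: "integrable (P t x) f" if "0 \<le> x" "f \<in> borel_measurable Rplus"
    "\<And>u. 0 \<le> u \<Longrightarrow> 0 \<le> f u" "\<And>u. 0 \<le> u \<Longrightarrow> f u \<le> 1" for f :: "real \<Rightarrow> real" and x
  proof -
    interpret prob_space "P t x" by (rule prob_space_P) (use t that in auto)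
    show ?thesis
    proof (rule integrable_const_bound[where B=1])
      show "AE u in P t x. norm (f u) \<le> 1"
      proof (rule AE_I2)
        fix u assume "u \<in> space (P t x)"
        then have "0 \<le> u" using sp[OF that(1)] by simp
        then show "norm (f u) \<le> 1" using that(3)[of u] that(4)[of u] by simp
      qed
    qed (rule mP[OF that(1,2)])
  qed
  have le: "exp (- y * w) * (\<integral>x. f x \<partial>P t 0) \<le> (\<integral>x. f x \<partial>P t y)"
    if f: "f \<in> borel_measurable Rplus" "\<And>u. 0 \<le> u \<Longrightarrow> 0 \<le> f u" "\<And>u. 0 \<le> u \<Longrightarrow> f u \<le> 1" for f :: "real \<Rightarrow> real"
  proof -
    let ?D = "density (P t 0) (\<lambda>_. ennreal (exp (- y * w)))"
    have fm: "(\<lambda>x. ennreal (f x)) \<in> borel_measurable (P t 0)" using mP[OF order_refl f(1)] by simp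
    have "(\<integral>\<^sup>+x. ennreal (f x) \<partial>?D) \<le> (\<integral>\<^sup>+x. ennreal (f x) \<partial>P t y)"
      by (rule nn_integral_mono_measure[OF _ transition_dominates[OF t y w]]) (use t y in \<open>auto simp: sets_P\<close>)
    moreover have "(\<integral>\<^sup>+x. ennreal (f x) \<partial>?D) = ennreal (exp (- y * w)) * (\<integral>\<^sup>+x. ennreal (f x) \<partial>P t 0)"
      using fm by (subst nn_integral_density) (auto simp: nn_integral_cmult)
    moreover have "(\<integral>\<^sup>+x. ennreal (f x) \<partial>P t x) = ennreal (\<integral>x. f x \<partial>P t x)" if "0 \<le> x" for x
      using int[OF that f] that by (intro nn_integral_eq_integral) (auto intro!: AE_I2 simp: sp f)
    moreover have "0 \<le> (\<integral>x. f x \<partial>P t x)" if "0 \<le> x" for x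
      using that by (intro Bochner_Integration.integral_nonneg) (auto simp: sp f)
    ultimately show ?thesis using y by (simp add: ennreal_mult[symmetric])
  qed
  define \<alpha> where "\<alpha> = exp (- y * w)"
  have w0: "0 \<le> w" using w[of 0] v_nonneg[of 0 t] t by simp
  have \<alpha>: "\<alpha> \<le> 1" using y w0 by (simp add: \<alpha>_def)
  have 1: "\<alpha> * (\<integral>x. h x \<partial>P t 0) \<le> (\<integral>x. h x \<partial>P t y)"
    unfolding \<alpha>_def by (rule le) (use h in auto)
  have "\<alpha> * (\<integral>x. 1 - h x \<partial>P t 0) \<le> (\<integral>x. 1 - h x \<partial>P t y)"
    unfolding \<alpha>_def by (rule le) (use h in auto)
  then have 2: "\<alpha> * (1 - (\<integral>x. h x \<partial>P t 0)) \<le> 1 - (\<integral>x. h x \<partial>P t y)"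
    using int[OF order_refl h] int[OF y h]
    by (simp add: Bochner_Integration.integral_diff P0.prob_space Py.prob_space)
  have h0: "0 \<le> (\<integral>x. h x \<partial>P t 0)" by (intro Bochner_Integration.integral_nonneg) (auto simp: sp h)
  have "(\<integral>x. h x \<partial>P t 0) \<le> (\<integral>x. 1 \<partial>P t 0)"
    using int[OF order_refl h] by (intro integral_mono) (auto simp: sp h)
  then have h1: "(\<integral>x. h x \<partial>P t 0) \<le> 1" by (simp add: P0.prob_space)
  have "(1 - \<alpha>) * (\<integral>x. h x \<partial>P t 0) \<le> 1 - \<alpha>" using h1 \<alpha> by (intro mult_left_le) auto
  moreover have "0 \<le> (1 - \<alpha>) * (\<integral>x. h x \<partial>P t 0)" using h0 \<alpha> by auto
  ultimately show ?thesis using 1 2 unfolding \<alpha>_def[symmetric] by (simp add: algebra_simps abs_le_iff)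
qed

end

section \<open>The stationary law near zero\<close>

locale stationary_cbi = subcritical_cbi +
  fixes \<mu> :: "real measure"
  assumes stationary: "stationary_distribution Rplus P \<mu>"
begin

lemma prob_space_\<mu>: "prob_space \<mu>" and sets_\<mu>: "sets \<mu> = sets Rplus"
  using stationary by (auto simp: stationary_distribution_def space_prob_algebra)

lemma space_\<mu>: "space \<mu> = {0..}"
  using sets_eq_imp_space_eq[OF sets_\<mu>] by (simp add: space_Rplus)

lemma measurable_\<mu>: "f \<in> borel_measurable borel \<Longrightarrow> f \<in> borel_measurable \<mu>"
  unfolding measurable_cong_sets[OF sets_\<mu> refl] by (rule measurable_Rplus)

lemma integrable_exp_\<mu>: "0 \<le> z \<Longrightarrow> integrable \<mu> (\<lambda>x. exp (- z * x))"
  by (rule integrable_laplace[OF prob_space_\<mu> sets_\<mu>])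

lemma laplace_\<mu>_invariant:
  assumes z: "0 \<le> z" and t: "0 \<le> t"
  shows "(\<integral>x. exp (- z * x) \<partial>\<mu>)
    = exp (- a * integral {0..t} (\<lambda>s. v s z)) * (\<integral>x. exp (- v t z * x) \<partial>\<mu>)"
proof -
  have em: "(\<lambda>y. ennreal (exp (- z * y))) \<in> borel_measurable Rplus"
    unfolding Rplus_def by (rule measurable_restrict_space1) simp
  have k: "P t \<in> \<mu> \<rightarrow>\<^sub>M subprob_algebra Rplus"
    using measurable_prob_algebraD[OF kernel[OF t]] by (simp add: measurable_cong_sets[OF sets_\<mu> refl])
  have "ennreal (\<integral>x. exp (- z * x) \<partial>\<mu>) = (\<integral>\<^sup>+x. ennreal (exp (- z * x)) \<partial>\<mu>)"
    by (rule nn_integral_eq_integral[symmetric, OF integrable_exp_\<mu>[OF z]]) simp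
  also have "\<dots> = (\<integral>\<^sup>+x. ennreal (exp (- z * x)) \<partial>(\<mu> \<bind> P t))"
    using stationary t by (simp add: stationary_distribution_def)
  also have "\<dots> = (\<integral>\<^sup>+x. \<integral>\<^sup>+y. ennreal (exp (- z * y)) \<partial>P t x \<partial>\<mu>)"
    by (rule nn_integral_bind[OF em k])
  also have "\<dots> = (\<integral>\<^sup>+x. ennreal (exp (- a * integral {0..t} (\<lambda>s. v s z)) * exp (- v t z * x)) \<partial>\<mu>)"
  proof (rule nn_integral_cong)
    fix x assume "x \<in> space \<mu>"
    then have x: "0 \<le> x" by (simp add: space_\<mu>)
    interpret prob_space "P t x" by (rule prob_space_P[OF t x])
    have "(\<integral>\<^sup>+y. ennreal (exp (- z * y)) \<partial>P t x) = ennreal (\<integral>y. exp (- z * y) \<partial>P t x)"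
      by (rule nn_integral_eq_integral[OF integrable_laplace[OF prob_space_P[OF t x] sets_P[OF t x] z]]) simp
    also have "\<dots> = ennreal (exp (- a * integral {0..t} (\<lambda>s. v s z)) * exp (- v t z * x))"
      unfolding laplace_P[OF t x z] by (simp add: exp_add[symmetric] algebra_simps)
    finally show "(\<integral>\<^sup>+y. ennreal (exp (- z * y)) \<partial>P t x)
        = ennreal (exp (- a * integral {0..t} (\<lambda>s. v s z)) * exp (- v t z * x))" .
  qed
  also have "\<dots> = ennreal (\<integral>x. exp (- a * integral {0..t} (\<lambda>s. v s z)) * exp (- v t z * x) \<partial>\<mu>)"
    by (rule nn_integral_eq_integral[OF integrable_mult_right[OF integrable_exp_\<mu>[OF v_nonneg[OF z t]]]]) simp
  finally show ?thesis
    by (simp add: Bochner_Integration.integral_nonneg ennreal_inj)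
qed

text \<open>In the invariance relation for the transform, let \<open>t\<close> tend to infinity: \<open>v\<^sub>t(z)\<close> tends to \<open>0\<close>, so the transform equals
  \<open>exp (- a \<integral>\<^sub>0\<^sup>\<infinity> v\<^sub>s(z) ds)\<close>, and the integral over all times is at most \<open>z / b\<close>.\<close>

lemma laplace_\<mu>_ge:
  assumes z: "0 \<le> z"
  shows "1 - a * z / b \<le> (\<integral>x. exp (- z * x) \<partial>\<mu>)"
proof -
  interpret prob_space \<mu> by (rule prob_space_\<mu>)
  have v0: "(\<lambda>n. v (real n) z) \<longlonglongrightarrow> 0"
  proof (rule tendsto_sandwich[of "\<lambda>_. 0"])
    have "(\<lambda>n. z * exp (- b) ^ n) \<longlonglongrightarrow> z * 0"
      using b_pos by (intro tendsto_mult_left LIMSEQ_realpow_zero) auto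
    then show "(\<lambda>n. z * exp (- b) ^ n) \<longlonglongrightarrow> 0" by simp
    show "\<forall>\<^sub>F n in sequentially. v (real n) z \<le> z * exp (- b) ^ n"
      using v_le_exp[OF z of_nat_0_le_iff]
      by (intro always_eventually allI) (simp add: exp_of_nat_mult[symmetric] mult.commute[of b])
    show "\<forall>\<^sub>F n in sequentially. 0 \<le> v (real n) z"
      using v_nonneg[OF z] by simp
  qed simp
  have "(\<lambda>n. \<integral>x. exp (- v (real n) z * x) \<partial>\<mu>) \<longlonglongrightarrow> (\<integral>x. exp (- 0 * x) \<partial>\<mu>)"
  proof (rule integral_dominated_convergence[where w="\<lambda>_. 1"])
    show "AE x in \<mu>. (\<lambda>n. exp (- v (real n) z * x)) \<longlonglongrightarrow> exp (- 0 * x)"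
      by (intro AE_I2 tendsto_intros v0)
    show "AE x in \<mu>. norm (exp (- v (real n) z * x)) \<le> 1" for n
      using v_nonneg[OF z, of "real n"] by (auto intro!: AE_I2 simp: space_\<mu>)
  qed (auto intro!: measurable_\<mu>)
  then have "(\<lambda>n. exp (- (a * z / b)) * (\<integral>x. exp (- v (real n) z * x) \<partial>\<mu>)) \<longlonglongrightarrow> exp (- (a * z / b)) * 1"
    by (intro tendsto_mult_left) (simp add: prob_space)
  moreover have "exp (- (a * z / b)) * (\<integral>x. exp (- v (real n) z * x) \<partial>\<mu>) \<le> (\<integral>x. exp (- z * x) \<partial>\<mu>)" for n
  proof -
    have "a * integral {0..real n} (\<lambda>s. v s z) \<le> a * (z / b)"
      using integral_v_le[OF z, of "real n"] a_nonneg by (intro mult_left_mono) auto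
    then have "exp (- (a * z / b)) \<le> exp (- a * integral {0..real n} (\<lambda>s. v s z))" by simp
    then show ?thesis
      using laplace_\<mu>_invariant[OF z, of "real n"]
      by (auto intro!: mult_right_mono Bochner_Integration.integral_nonneg)
  qed
  ultimately have "exp (- (a * z / b)) \<le> (\<integral>x. exp (- z * x) \<partial>\<mu>)"
    by (intro LIMSEQ_le_const2) auto
  then show ?thesis using exp_ge_add_one_self[of "- (a * z / b)"] by simp
qed

end

section \<open>Covariance bounds extend from an algebra to the generated sigma-algebra\<close>

lemma (in prob_space) abs_prob_diff_le:
  assumes "A \<in> events" "B \<in> events"
  shows "\<bar>prob A - prob B\<bar> \<le> prob (sym_diff A B)"
proof -
  have *: "prob X \<le> prob Y + prob (sym_diff X Y)" if "X \<in> events" "Y \<in> events" for X Y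
  proof -
    have "prob X \<le> prob (Y \<union> sym_diff X Y)" using that by (intro finite_measure_mono) auto
    also have "\<dots> \<le> prob Y + prob (sym_diff X Y)" using that by (intro measure_Un_le) auto
    finally show ?thesis .
  qed
  show ?thesis using *[OF assms] *[OF assms(2,1)] by (simp add: Un_commute abs_le_iff)
qed

text \<open>The sets that can be approximated form a \<open>\<sigma>\<close>-algebra: for a countable union, approximate
  the first \<open>n\<close> sets and use continuity from below for the rest.\<close>

lemma (in prob_space) approximation_by_algebra:
  assumes alg: "algebra (space M) \<A>" "\<A> \<subseteq> events"
    and E: "E \<in> sigma_sets (space M) \<A>" and e: "0 < (e :: real)"
  shows "\<exists>E'\<in>\<A>. prob (sym_diff E E') < e"
  using E e
proof (induction arbitrary: e rule: sigma_sets.induct)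
  case (Basic X)
  then show ?case by (intro bexI[of _ X]) auto
next
  case Empty
  interpret algebra "space M" \<A> by fact
  show ?case using Empty by (intro bexI[of _ "{}"]) auto
next
  case (Compl X)
  interpret alg: algebra "space M" \<A> by fact
  from Compl.IH[OF Compl.prems] obtain X' where X': "X' \<in> \<A>" "prob (sym_diff X X') < e" by blast
  have "X \<subseteq> space M" using sigma_sets_into_sp[OF _ Compl.hyps] alg.space_closed by auto
  moreover have "X' \<subseteq> space M" using X' alg.space_closed by auto
  ultimately have "sym_diff (space M - X) (space M - X') = sym_diff X X'" by auto
  then show ?case using X' by (intro bexI[of _ "space M - X'"]) auto
next
  case (Union X)
  interpret alg: algebra "space M" \<A> by fact
  have sub: "sigma_sets (space M) \<A> \<subseteq> events" using alg(2) by (rule sets.sigma_sets_subset)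
  then have Xe: "X i \<in> events" for i using Union.hyps by blast
  have "(\<lambda>n. prob (\<Union>i<n. X i)) \<longlonglongrightarrow> prob (\<Union>n. \<Union>i<n. X i)"
    by (rule finite_Lim_measure_incseq) (use Xe in \<open>auto simp: incseq_def\<close>, fastforce)
  moreover have "(\<Union>n. \<Union>i<n. X i) = (\<Union>i. X i)" by blast
  ultimately have lim: "(\<lambda>n. prob (\<Union>i<n. X i)) \<longlonglongrightarrow> prob (\<Union>i. X i)" by simp
  obtain n where n: "\<bar>prob (\<Union>i<n. X i) - prob (\<Union>i. X i)\<bar> < e / 2"
    using LIMSEQ_D[OF lim, of "e / 2"] Union.prems by auto
  have "\<exists>E'\<in>\<A>. prob (sym_diff (X i) E') < e / (2 * real (Suc n))" for i
    using Union.prems by (intro Union.IH) auto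
  then obtain X' where X': "\<And>i. X' i \<in> \<A>" "\<And>i. prob (sym_diff (X i) (X' i)) < e / (2 * real (Suc n))"
    by metis
  then have X'e: "X' i \<in> events" for i using alg(2) by blast
  show ?case
  proof (intro bexI[of _ "\<Union>i<n. X' i"])
    show "(\<Union>i<n. X' i) \<in> \<A>" using X' by (intro alg.finite_UN) auto
    have "prob (sym_diff (\<Union>i. X i) (\<Union>i<n. X' i))
        \<le> prob (((\<Union>i. X i) - (\<Union>i<n. X i)) \<union> (\<Union>i<n. sym_diff (X i) (X' i)))"
      using Xe X'e by (intro finite_measure_mono) auto
    also have "\<dots> \<le> prob ((\<Union>i. X i) - (\<Union>i<n. X i)) + prob (\<Union>i<n. sym_diff (X i) (X' i))"
      using Xe X'e by (intro measure_Un_le) auto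
    also have "prob ((\<Union>i. X i) - (\<Union>i<n. X i)) = prob (\<Union>i. X i) - prob (\<Union>i<n. X i)"
      using Xe by (intro finite_measure_Diff) auto
    also have "prob (\<Union>i<n. sym_diff (X i) (X' i)) \<le> (\<Sum>i<n. prob (sym_diff (X i) (X' i)))"
      using Xe X'e by (intro finite_measure_subadditive_finite) auto
    also have "\<dots> \<le> (\<Sum>i<n. e / (2 * real (Suc n)))"
      using X'(2) by (intro sum_mono less_imp_le)
    also have "\<dots> \<le> e / 2" using Union.prems by (simp add: field_simps)
    finally show "prob (sym_diff (\<Union>i. X i) (\<Union>i<n. X' i)) < e" using n by linarith
  qed
qed

lemma (in prob_space) covariance_bound_extends:
  assumes alg: "algebra (space M) \<A>" "\<A> \<subseteq> events"
    and A: "A \<in> events" and B: "B \<in> sigma_sets (space M) \<A>"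
    and bound: "\<And>B. B \<in> \<A> \<Longrightarrow> \<bar>prob (A \<inter> B) - prob A * prob B\<bar> \<le> K"
  shows "\<bar>prob (A \<inter> B) - prob A * prob B\<bar> \<le> K"
proof (rule field_le_epsilon)
  fix e :: real assume "0 < e"
  then obtain B' where B': "B' \<in> \<A>" "prob (sym_diff B B') < e / 2"
    using approximation_by_algebra[OF alg B, of "e / 2"] by auto
  have Be: "B \<in> events" "B' \<in> events" using B B' alg sets.sigma_sets_subset[OF alg(2)] by auto
  have "\<bar>prob (A \<inter> B) - prob (A \<inter> B')\<bar> \<le> prob (sym_diff (A \<inter> B) (A \<inter> B'))"
    using A Be by (intro abs_prob_diff_le) auto
  also have "\<dots> \<le> prob (sym_diff B B')" using A Be by (intro finite_measure_mono) auto
  finally have 1: "\<bar>prob (A \<inter> B) - prob (A \<inter> B')\<bar> \<le> e / 2" using B' by simp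
  have "\<bar>prob A * prob B - prob A * prob B'\<bar> = prob A * \<bar>prob B - prob B'\<bar>"
    by (simp add: right_diff_distrib[symmetric] abs_mult)
  also have "\<dots> \<le> 1 * (e / 2)"
    using abs_prob_diff_le[OF Be] B' by (intro mult_mono) auto
  finally show "\<bar>prob (A \<inter> B) - prob A * prob B\<bar> \<le> K + e"
    using 1 bound[OF B'(1)] by linarith
qed

section \<open>The Markov property from the finite-dimensional distributions\<close>

locale markov_process = prob_space M for M :: "'w measure" +
  fixes S :: "'s measure" and P :: "real \<Rightarrow> 's \<Rightarrow> 's measure" and \<mu> :: "'s measure"
    and Y :: "real \<Rightarrow> 'w \<Rightarrow> 's"
  assumes kernels: "\<And>t. 0 \<le> t \<Longrightarrow> P t \<in> S \<rightarrow>\<^sub>M prob_algebra S"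
    and fdd: "markov_process_with_fdd M S P \<mu> Y"
begin

lemma measurable_Y [measurable]: "Y t \<in> M \<rightarrow>\<^sub>M S"
  using fdd by (simp add: markov_process_with_fdd_def)

lemma prob_space_kernel: "0 \<le> t \<Longrightarrow> x \<in> space S \<Longrightarrow> prob_space (P t x)"
  and sets_kernel: "0 \<le> t \<Longrightarrow> x \<in> space S \<Longrightarrow> sets (P t x) = sets S"
  using measurable_space[OF kernels, of t x] by (simp_all add: space_prob_algebra)

text \<open>Observations are indexed by finite sets of real times. This makes merging the times of a past and a future event a
  union of sets, and the enumeration demanded by \<open>markov_fdd\<close> is confined to \<open>one_step_enumerated\<close> and \<open>one_step\<close>.\<close>

definition path :: "real set \<Rightarrow> 'w \<Rightarrow> real \<Rightarrow> 's" where
  "path J \<omega> = (\<lambda>j\<in>J. Y j \<omega>)"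

lemma measurable_path [measurable]: "path J \<in> M \<rightarrow>\<^sub>M PiM J (\<lambda>_. S)"
  unfolding path_def by measurable

lemma space_Y: "\<omega> \<in> space M \<Longrightarrow> Y t \<omega> \<in> space S"
  using measurable_space[OF measurable_Y] by blast

lemma one_step_enumerated:
  assumes t: "strict_mono_on {..Suc n} t" and F: "F \<in> borel_measurable (PiM {..Suc n} (\<lambda>_. S))"
  shows "(\<integral>\<^sup>+\<omega>. F (\<lambda>i\<in>{..Suc n}. Y (t i) \<omega>) \<partial>M)
    = (\<integral>\<^sup>+\<omega>. \<integral>\<^sup>+y. F ((\<lambda>i\<in>{..n}. Y (t i) \<omega>)(Suc n := y)) \<partial>P (t (Suc n) - t n) (Y (t n) \<omega>) \<partial>M)"
proof -
  let ?\<Pi> = "\<lambda>n. PiM {..n} (\<lambda>_. S)"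
  define d where "d = t (Suc n) - t n"
  have d: "0 \<le> d" using strict_mono_onD[OF t, of n "Suc n"] by (simp add: d_def)
  define K where "K x = distr (P d (x n)) (?\<Pi> (Suc n)) (\<lambda>y. x(Suc n := y))" for x
  have tn: "strict_mono_on {..n} t" using t by (rule monotone_on_subset) auto
  have law: "distr M (?\<Pi> k) (\<lambda>\<omega>. \<lambda>i\<in>{..k}. Y (t i) \<omega>) = markov_fdd S P \<mu> t k"
    if "strict_mono_on {..k} t" for k
    using fdd that by (simp add: markov_process_with_fdd_def)
  have Ym: "(\<lambda>\<omega>. \<lambda>i\<in>{..k}. Y (t i) \<omega>) \<in> M \<rightarrow>\<^sub>M ?\<Pi> k" for k by measurable
  have comp: "(\<lambda>x. x n) \<in> ?\<Pi> n \<rightarrow>\<^sub>M S" by (rule measurable_component_singleton) simp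
  have upd: "(\<lambda>(x, y). x(Suc n := y)) \<in> ?\<Pi> n \<Otimes>\<^sub>M S \<rightarrow>\<^sub>M ?\<Pi> (Suc n)"
    using measurable_add_dim[of "Suc n" "{..n}" "\<lambda>_. S"] by (simp add: atMost_Suc)
  have Pm: "(\<lambda>x. P d (x n)) \<in> ?\<Pi> n \<rightarrow>\<^sub>M subprob_algebra S"
    using measurable_compose[OF comp measurable_prob_algebraD[OF kernels[OF d]]] .
  have Km: "K \<in> ?\<Pi> n \<rightarrow>\<^sub>M subprob_algebra (?\<Pi> (Suc n))"
    unfolding K_def by (rule measurable_distr2[OF upd Pm])
  have "(\<integral>\<^sup>+\<omega>. F (\<lambda>i\<in>{..Suc n}. Y (t i) \<omega>) \<partial>M) = (\<integral>\<^sup>+x. F x \<partial>markov_fdd S P \<mu> t (Suc n))"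
    unfolding law[OF t, symmetric] using F by (simp only: nn_integral_distr[OF Ym] measurable_distr_eq1)
  also have "\<dots> = (\<integral>\<^sup>+x. F x \<partial>(markov_fdd S P \<mu> t n \<bind> K))"
    by (simp add: K_def[abs_def] d_def)
  also have "\<dots> = (\<integral>\<^sup>+x. \<integral>\<^sup>+z. F z \<partial>K x \<partial>markov_fdd S P \<mu> t n)"
    by (rule nn_integral_bind[OF F]) (simp only: law[OF tn, symmetric] measurable_distr_eq1 Km)
  also have "\<dots> = (\<integral>\<^sup>+\<omega>. \<integral>\<^sup>+z. F z \<partial>K (\<lambda>i\<in>{..n}. Y (t i) \<omega>) \<partial>M)"
    unfolding law[OF tn, symmetric]
    using measurable_compose[OF Km nn_integral_measurable_subprob_algebra[OF F]]
    by (simp only: nn_integral_distr[OF Ym] measurable_distr_eq1)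
  also have "\<dots> = (\<integral>\<^sup>+\<omega>. \<integral>\<^sup>+y. F ((\<lambda>i\<in>{..n}. Y (t i) \<omega>)(Suc n := y)) \<partial>P d (Y (t n) \<omega>) \<partial>M)"
  proof (rule nn_integral_cong)
    fix \<omega> assume \<omega>: "\<omega> \<in> space M"
    define x where "x = (\<lambda>i\<in>{..n}. Y (t i) \<omega>)"
    have x: "x \<in> space (?\<Pi> n)" using measurable_space[OF Ym \<omega>] by (simp add: x_def)
    have "(\<lambda>y. x(Suc n := y)) \<in> S \<rightarrow>\<^sub>M ?\<Pi> (Suc n)"
      using measurable_compose[OF measurable_Pair1'[OF x] upd] by simp
    then have "(\<lambda>y. x(Suc n := y)) \<in> P d (Y (t n) \<omega>) \<rightarrow>\<^sub>M ?\<Pi> (Suc n)"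
      by (simp add: measurable_cong_sets[OF sets_kernel[OF d space_Y[OF \<omega>]] refl])
    moreover have xn: "x n = Y (t n) \<omega>" by (simp add: x_def)
    ultimately have "(\<integral>\<^sup>+z. F z \<partial>K x) = (\<integral>\<^sup>+y. F (x(Suc n := y)) \<partial>P d (Y (t n) \<omega>))"
      unfolding K_def using F by (simp only: nn_integral_distr measurable_distr_eq1)
    then show "(\<integral>\<^sup>+z. F z \<partial>K (\<lambda>i\<in>{..n}. Y (t i) \<omega>))
        = (\<integral>\<^sup>+y. F ((\<lambda>i\<in>{..n}. Y (t i) \<omega>)(Suc n := y)) \<partial>P d (Y (t n) \<omega>))"
      unfolding x_def .
  qed
  finally show ?thesis by (simp only: d_def)
qed

text \<open>The finite-dimensional laws are indexed by positions, which are translated into times by sorting \<open>J\<close>.\<close>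

lemma one_step:
  assumes J: "finite J" "s \<in> J" "\<And>j. j \<in> J \<Longrightarrow> j \<le> s" and u: "s < u"
    and F: "F \<in> borel_measurable (PiM (insert u J) (\<lambda>_. S))"
  shows "(\<integral>\<^sup>+\<omega>. F (path (insert u J) \<omega>) \<partial>M)
    = (\<integral>\<^sup>+\<omega>. \<integral>\<^sup>+y. F ((path J \<omega>)(u := y)) \<partial>P (u - s) (Y s \<omega>) \<partial>M)"
proof -
  define xs where "xs = sorted_list_of_set J"
  have xs: "set xs = J" "sorted_wrt (<) xs" using J by (simp_all add: xs_def)
  then obtain n where n: "length xs = Suc n" using J by (cases xs) auto
  define t where "t i = (if i \<le> n then xs ! i else u)" for i
  have tJ: "t i \<in> J" if "i \<le> n" for i using that n xs(1) by (auto simp: t_def)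
  have uJ: "u \<notin> J" using J u by force
  have mono: "strict_mono_on {..Suc n} t"
  proof (rule strict_mono_onI)
    fix i j assume "i \<in> {..Suc n}" "j \<in> {..Suc n}" "i < j"
    then show "t i < t j"
      using sorted_wrt_nth_less[OF xs(2), of i j] n tJ[of i] J(3)[of "t i"] u
      by (cases "j = Suc n") (auto simp: t_def)
  qed
  have range: "\<exists>i\<le>n. j = t i" if j: "j \<in> J" for j
  proof -
    obtain i where "i < length xs" "xs ! i = j" using j xs(1) by (metis in_set_conv_nth)
    then show ?thesis using n by (intro exI[of _ i]) (auto simp: t_def)
  qed
  have tu: "t (Suc n) = u" by (simp add: t_def)
  have "s \<le> t n"
  proof -
    obtain i where "i \<le> n" "s = t i" using range J by blast
    then show ?thesis using strict_mono_onD[OF mono, of i n] by (cases "i = n") auto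
  qed
  then have tn: "t n = s" using J(3)[OF tJ[of n]] by simp
  define ix where "ix = inv_into {..Suc n} t"
  have inj: "inj_on t {..Suc n}" using mono by (rule strict_mono_on_imp_inj_on)
  have ix_t: "ix (t i) = i" if "i \<le> Suc n" for i
    unfolding ix_def using inj that by (intro inv_into_f_f) auto
  have t_ix: "ix j \<le> n" "t (ix j) = j" if "j \<in> J" for j
    using range[OF that] ix_t by auto
  have ix_u: "ix u = Suc n" using ix_t[of "Suc n"] tu by simp
  \<comment> \<open>Relabels a vector of observations from positions to times.\<close>
  define e :: "(nat \<Rightarrow> 's) \<Rightarrow> real \<Rightarrow> 's" where "e x = (\<lambda>j\<in>insert u J. x (ix j))" for x
  have em: "e \<in> PiM {..Suc n} (\<lambda>_. S) \<rightarrow>\<^sub>M PiM (insert u J) (\<lambda>_. S)"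
    unfolding e_def
  proof (rule measurable_restrict)
    fix j assume "j \<in> insert u J"
    then show "(\<lambda>x. x (ix j)) \<in> PiM {..Suc n} (\<lambda>_. S) \<rightarrow>\<^sub>M S"
      using t_ix(1)[of j] ix_u by (intro measurable_component_singleton) auto
  qed
  have e1: "e (\<lambda>i\<in>{..Suc n}. Y (t i) \<omega>) = path (insert u J) \<omega>" for \<omega>
    using t_ix ix_u tu by (auto simp: e_def path_def fun_eq_iff le_Suc_eq)
  have e2: "e ((\<lambda>i\<in>{..n}. Y (t i) \<omega>)(Suc n := y)) = (path J \<omega>)(u := y)" for \<omega> y
  proof (rule ext)
    fix j show "e ((\<lambda>i\<in>{..n}. Y (t i) \<omega>)(Suc n := y)) j = ((path J \<omega>)(u := y)) j"
      using t_ix[of j] ix_u by (auto simp: e_def path_def)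
  qed
  have "F \<circ> e \<in> borel_measurable (PiM {..Suc n} (\<lambda>_. S))"
    using measurable_compose[OF em F] by (simp add: comp_def)
  from one_step_enumerated[OF mono this] show ?thesis
    by (simp only: comp_def e1 e2 tu tn)
qed

text \<open>A function of the future after \<open>s\<close> can be replaced by a function of \<open>Y\<^sub>s\<close> when it is averaged together with
  the past: integrate out the latest time with the transition kernel and repeat. The function \<open>h\<close> is
  quantified before \<open>J\<close> and \<open>G\<close>, as one \<open>h\<close> has to serve all past events.\<close>

lemma conditional_future:
  assumes "finite L" "\<forall>l\<in>L. s < l"
    and F: "F \<in> borel_measurable (PiM (insert s L) (\<lambda>_. S))"
    "\<forall>x\<in>space (PiM (insert s L) (\<lambda>_. S)). F x \<le> (1 :: ennreal)"
  shows "\<exists>h\<in>borel_measurable S. (\<forall>y\<in>space S. h y \<le> 1) \<and>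
    (\<forall>J G. finite J \<longrightarrow> s \<in> J \<longrightarrow> (\<forall>j\<in>J. j \<le> s) \<longrightarrow> G \<in> borel_measurable (PiM J (\<lambda>_. S)) \<longrightarrow>
      (\<integral>\<^sup>+\<omega>. G (path J \<omega>) * F (path (insert s L) \<omega>) \<partial>M) = (\<integral>\<^sup>+\<omega>. G (path J \<omega>) * h (Y s \<omega>) \<partial>M))"
  using assms
proof (induction L arbitrary: F rule: finite_linorder_max_induct)
  case empty
  have m: "(\<lambda>y. \<lambda>i\<in>{s}. y) \<in> S \<rightarrow>\<^sub>M PiM {s} (\<lambda>_. S)" by measurable
  show ?case
  proof (intro bexI[of _ "\<lambda>y. F (\<lambda>i\<in>{s}. y)"] conjI ballI allI impI)
    show "F (\<lambda>i\<in>{s}. y) \<le> 1" if "y \<in> space S" for y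
      by (rule bspec[OF empty.prems(3) measurable_space[OF m that]])
    show "(\<lambda>y. F (\<lambda>i\<in>{s}. y)) \<in> borel_measurable S"
      by (rule measurable_compose[OF m empty.prems(2)])
    have "path {s} \<omega> = (\<lambda>i\<in>{s}. Y s \<omega>)" for \<omega> by (simp add: path_def fun_eq_iff)
    then show "(\<integral>\<^sup>+\<omega>. G (path J \<omega>) * F (path {s} \<omega>) \<partial>M)
        = (\<integral>\<^sup>+\<omega>. G (path J \<omega>) * F (\<lambda>i\<in>{s}. Y s \<omega>) \<partial>M)" for J and G :: "_ \<Rightarrow> ennreal"
      by (simp only:)
  qed
next
  case (insert u L)
  let ?K = "insert s L"
  define r where "r = Max ?K"
  have K: "finite ?K" "r \<in> ?K" "\<And>j. j \<in> ?K \<Longrightarrow> j \<le> r"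
    unfolding r_def using insert.hyps(1) Max_in[of ?K] by auto
  have su: "s < u" using insert.prems(1) by simp
  have ru: "r < u" using K(2) insert.hyps(2) su by auto
  have sr: "s \<le> r" using K(3) by simp
  have uK: "u \<notin> ?K" using K(3) ru by force
  have comm: "insert s (insert u L) = insert u ?K" by auto
  have F1: "F \<in> borel_measurable (PiM (insert u ?K) (\<lambda>_. S))" using insert.prems(2) by (simp only: comm)
  have F2: "F x \<le> 1" if "x \<in> space (PiM (insert u ?K) (\<lambda>_. S))" for x
    using bspec[OF insert.prems(3)[unfolded comm] that] .
  define F' where "F' x = (\<integral>\<^sup>+y. F (x(u := y)) \<partial>P (u - r) (x r))" for x
  have d: "0 \<le> u - r" using ru by simp
  have upd: "(\<lambda>(x, y). x(u := y)) \<in> PiM ?K (\<lambda>_. S) \<Otimes>\<^sub>M S \<rightarrow>\<^sub>M PiM (insert u ?K) (\<lambda>_. S)"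
    by (rule measurable_add_dim)
  have comp: "(\<lambda>x. x r) \<in> PiM ?K (\<lambda>_. S) \<rightarrow>\<^sub>M S" by (rule measurable_component_singleton[OF K(2)])
  have F'm: "F' \<in> borel_measurable (PiM ?K (\<lambda>_. S))"
    unfolding F'_def
  proof (rule nn_integral_measurable_subprob_algebra2)
    show "(\<lambda>(x, y). F (x(u := y))) \<in> borel_measurable (PiM ?K (\<lambda>_. S) \<Otimes>\<^sub>M S)"
      using measurable_compose[OF upd F1] by (simp add: case_prod_beta')
    show "(\<lambda>x. P (u - r) (x r)) \<in> PiM ?K (\<lambda>_. S) \<rightarrow>\<^sub>M subprob_algebra S"
      by (rule measurable_compose[OF comp measurable_prob_algebraD[OF kernels[OF d]]])
  qed
  have upd_space: "x(u := y) \<in> space (PiM (insert u ?K) (\<lambda>_. S))"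
    if "x \<in> space (PiM ?K (\<lambda>_. S))" "y \<in> space S" for x y
    using measurable_space[OF upd, of "(x, y)"] that by (simp add: space_pair_measure)
  have F'1: "F' x \<le> 1" if x: "x \<in> space (PiM ?K (\<lambda>_. S))" for x
  proof -
    have xr: "x r \<in> space S" by (rule measurable_space[OF comp x])
    interpret k: prob_space "P (u - r) (x r)" by (rule prob_space_kernel[OF d xr])
    have "F' x \<le> (\<integral>\<^sup>+y. 1 \<partial>P (u - r) (x r))"
      unfolding F'_def using sets_eq_imp_space_eq[OF sets_kernel[OF d xr]]
      by (intro nn_integral_mono F2 upd_space x) auto
    then show ?thesis by (simp add: k.emeasure_space_1)
  qed
  have "\<forall>l\<in>L. s < l" using insert.prems(1) by simp
  moreover have "\<forall>x\<in>space (PiM ?K (\<lambda>_. S)). F' x \<le> 1" using F'1 by blast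
  ultimately have "\<exists>h\<in>borel_measurable S. (\<forall>y\<in>space S. h y \<le> 1) \<and>
    (\<forall>J G. finite J \<longrightarrow> s \<in> J \<longrightarrow> (\<forall>j\<in>J. j \<le> s) \<longrightarrow> G \<in> borel_measurable (PiM J (\<lambda>_. S)) \<longrightarrow>
      (\<integral>\<^sup>+\<omega>. G (path J \<omega>) * F' (path ?K \<omega>) \<partial>M) = (\<integral>\<^sup>+\<omega>. G (path J \<omega>) * h (Y s \<omega>) \<partial>M))"
    by (intro insert.IH F'm)
  then
  obtain h where h: "h \<in> borel_measurable S" "\<forall>y\<in>space S. h y \<le> 1"
    "\<forall>J G. finite J \<longrightarrow> s \<in> J \<longrightarrow> (\<forall>j\<in>J. j \<le> s) \<longrightarrow> G \<in> borel_measurable (PiM J (\<lambda>_. S)) \<longrightarrow>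
      (\<integral>\<^sup>+\<omega>. G (path J \<omega>) * F' (path ?K \<omega>) \<partial>M) = (\<integral>\<^sup>+\<omega>. G (path J \<omega>) * h (Y s \<omega>) \<partial>M)"
    by (elim bexE conjE)
  have "(\<integral>\<^sup>+\<omega>. G (path J \<omega>) * F (path (insert u ?K) \<omega>) \<partial>M) = (\<integral>\<^sup>+\<omega>. G (path J \<omega>) * h (Y s \<omega>) \<partial>M)"
    if J: "finite J" "s \<in> J" "\<forall>j\<in>J. j \<le> s" and G: "G \<in> borel_measurable (PiM J (\<lambda>_. S))" for J and G :: "_ \<Rightarrow> ennreal"
  proof -
    have uJ: "u \<notin> J" using J(3) su by force
    define H where "H x = G (restrict x J) * F (restrict x (insert u ?K))" for x
    have Gm: "(\<lambda>x. G (restrict x J)) \<in> borel_measurable (PiM (insert u (J \<union> ?K)) (\<lambda>_. S))"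
      by (rule measurable_compose[OF measurable_restrict_subset G]) auto
    have Fm: "(\<lambda>x. F (restrict x (insert u ?K))) \<in> borel_measurable (PiM (insert u (J \<union> ?K)) (\<lambda>_. S))"
      by (rule measurable_compose[OF measurable_restrict_subset F1]) auto
    have Hm: "H \<in> borel_measurable (PiM (insert u (J \<union> ?K)) (\<lambda>_. S))"
      unfolding H_def using Gm Fm by (rule borel_measurable_times_ennreal)
    have p1: "restrict (path I \<omega>) I' = path I' \<omega>" if "I' \<subseteq> I" for I I' \<omega>
      using that by (simp add: path_def restrict_restrict Int_absorb1)
    have p2: "restrict ((path (J \<union> ?K) \<omega>)(u := y)) J = path J \<omega>" for \<omega> y
      using uJ by (auto simp: path_def fun_eq_iff restrict_def)
    have p3: "restrict ((path (J \<union> ?K) \<omega>)(u := y)) (insert u ?K) = (path ?K \<omega>)(u := y)" for \<omega> y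
      using uK by (auto simp: path_def fun_eq_iff restrict_def)
    have "(\<integral>\<^sup>+\<omega>. G (path J \<omega>) * F (path (insert u ?K) \<omega>) \<partial>M) = (\<integral>\<^sup>+\<omega>. H (path (insert u (J \<union> ?K)) \<omega>) \<partial>M)"
      unfolding H_def by (intro nn_integral_cong arg_cong2[where f="(*)"] arg_cong[where f=G] arg_cong[where f=F] p1[symmetric]) auto
    also have "\<dots> = (\<integral>\<^sup>+\<omega>. \<integral>\<^sup>+y. H ((path (J \<union> ?K) \<omega>)(u := y)) \<partial>P (u - r) (Y r \<omega>) \<partial>M)"
      by (rule one_step[OF _ _ _ ru Hm]) (use J K sr in \<open>auto intro: order_trans\<close>)
    also have "\<dots> = (\<integral>\<^sup>+\<omega>. G (path J \<omega>) * F' (path ?K \<omega>) \<partial>M)"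
    proof (rule nn_integral_cong)
      fix \<omega> assume \<omega>: "\<omega> \<in> space M"
      have pr: "path ?K \<omega> r = Y r \<omega>" using K(2) by (simp add: path_def)
      have x: "path ?K \<omega> \<in> space (PiM ?K (\<lambda>_. S))" by (rule measurable_space[OF measurable_path \<omega>])
      have "(\<lambda>y. F ((path ?K \<omega>)(u := y))) \<in> borel_measurable S"
        using measurable_compose[OF measurable_Pair1'[OF x] measurable_compose[OF upd F1]] by simp
      then have "(\<lambda>y. F ((path ?K \<omega>)(u := y))) \<in> borel_measurable (P (u - r) (Y r \<omega>))"
        by (simp add: measurable_cong_sets[OF sets_kernel[OF d space_Y[OF \<omega>]] refl])
      then show "(\<integral>\<^sup>+y. H ((path (J \<union> ?K) \<omega>)(u := y)) \<partial>P (u - r) (Y r \<omega>)) = G (path J \<omega>) * F' (path ?K \<omega>)"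
        unfolding H_def p2 p3 F'_def pr by (rule nn_integral_cmult)
    qed
    also have "\<dots> = (\<integral>\<^sup>+\<omega>. G (path J \<omega>) * h (Y s \<omega>) \<partial>M)" by (rule h(3)[rule_format, OF J(1,2) _ G]) (use J(3) in blast)
    finally show ?thesis .
  qed
  then show ?case unfolding comm using h(1,2) by (intro bexI[of _ h] conjI allI impI)
qed

definition cylinders :: "real set \<Rightarrow> 'w set set" where
  "cylinders I = {path J -` D \<inter> space M | J D. finite J \<and> J \<subseteq> I \<and> D \<in> sets (PiM J (\<lambda>_. S))}"

lemma cylinders_events: "cylinders I \<subseteq> events"
  unfolding cylinders_def by (auto intro: measurable_sets[OF measurable_path])

lemma cylindersI:
  "finite J \<Longrightarrow> J \<subseteq> I \<Longrightarrow> D \<in> sets (PiM J (\<lambda>_. S)) \<Longrightarrow> path J -` D \<inter> space M \<in> cylinders I"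
  unfolding cylinders_def by blast

lemma cylindersE:
  assumes "A \<in> cylinders I"
  obtains J D where "A = path J -` D \<inter> space M" "finite J" "J \<subseteq> I" "D \<in> sets (PiM J (\<lambda>_. S))"
  using assms unfolding cylinders_def by blast

lemma algebra_cylinders: "algebra (space M) (cylinders I)"
  unfolding algebra_iff_Un
proof (intro conjI ballI)
  show "cylinders I \<subseteq> Pow (space M)" by (auto simp: cylinders_def)
  show "{} \<in> cylinders I" using cylindersI[of "{}" I "{}"] by simp
next
  fix A assume "A \<in> cylinders I"
  then obtain J D where A: "A = path J -` D \<inter> space M" "finite J" "J \<subseteq> I" "D \<in> sets (PiM J (\<lambda>_. S))"
    unfolding cylinders_def by blast
  have "space M - A = path J -` (space (PiM J (\<lambda>_. S)) - D) \<inter> space M"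
    using measurable_space[OF measurable_path[of J]] by (auto simp: A(1))
  then show "space M - A \<in> cylinders I" using A by (auto intro!: cylindersI)
next
  fix A B assume "A \<in> cylinders I" "B \<in> cylinders I"
  then obtain J1 D1 J2 D2 where A: "A = path J1 -` D1 \<inter> space M" "finite J1" "J1 \<subseteq> I" "D1 \<in> sets (PiM J1 (\<lambda>_. S))"
    and B: "B = path J2 -` D2 \<inter> space M" "finite J2" "J2 \<subseteq> I" "D2 \<in> sets (PiM J2 (\<lambda>_. S))"
    unfolding cylinders_def by blast
  let ?\<Pi> = "PiM (J1 \<union> J2) (\<lambda>_. S)"
  have r: "restrict (path (J1 \<union> J2) \<omega>) J1 = path J1 \<omega>" "restrict (path (J1 \<union> J2) \<omega>) J2 = path J2 \<omega>" for \<omega>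
    by (auto simp: path_def fun_eq_iff restrict_def)
  define D where "D = ((\<lambda>x. restrict x J1) -` D1 \<inter> space ?\<Pi>) \<union> ((\<lambda>x. restrict x J2) -` D2 \<inter> space ?\<Pi>)"
  have "D \<in> sets ?\<Pi>" unfolding D_def
    by (intro sets.Un measurable_sets[OF measurable_restrict_subset] A B) auto
  moreover have "A \<union> B = path (J1 \<union> J2) -` D \<inter> space M"
    using measurable_space[OF measurable_path[of "J1 \<union> J2"]] by (auto simp: A(1) B(1) D_def r)
  ultimately show "A \<union> B \<in> cylinders I" using A B by (auto intro!: cylindersI)
qed

lemma generated_events_subset: "generated_events M S Y I \<subseteq> sigma_sets (space M) (cylinders I)"
  unfolding generated_events_def
proof (rule sigma_sets_mono', safe)
  fix s A assume s: "s \<in> I" and A: "A \<in> sets S"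
  let ?D = "(\<lambda>x. x s) -` A \<inter> space (PiM {s} (\<lambda>_. S))"
  have "?D \<in> sets (PiM {s} (\<lambda>_. S))"
    by (rule measurable_sets[OF _ A], rule measurable_component_singleton) simp
  moreover have "Y s -` A \<inter> space M = path {s} -` ?D \<inter> space M"
    using measurable_space[OF measurable_path[of "{s}"]] by (auto simp: path_def)
  moreover have "{s} \<subseteq> I" using s by simp
  ultimately show "Y s -` A \<inter> space M \<in> cylinders I" by (simp only: cylindersI finite.intros)
qed

text \<open>The function \<open>h\<close> of \<open>Y\<^sub>t\<close> that represents \<open>B\<close> is averaged over the last step, from time \<open>0\<close> to
  time \<open>t\<close>. The time \<open>t\<close> itself is observed by neither event and is inserted for this purpose.\<close>

lemma past_future_kernel:
  assumes t: "0 < t" and B: "B \<in> cylinders {t<..}"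
  obtains h where "h \<in> borel_measurable S" and "\<And>y. y \<in> space S \<Longrightarrow> h y \<le> (1 :: ennreal)"
    and "\<And>A. A \<in> cylinders {..0} \<Longrightarrow>
      emeasure M (A \<inter> B) = (\<integral>\<^sup>+\<omega>. indicator A \<omega> * (\<integral>\<^sup>+y. h y \<partial>P t (Y 0 \<omega>)) \<partial>M)"
proof -
  obtain L D2 where L: "B = path L -` D2 \<inter> space M" "finite L" "L \<subseteq> {t<..}" "D2 \<in> sets (PiM L (\<lambda>_. S))"
    using B by (rule cylindersE)
  define F :: "(real \<Rightarrow> 's) \<Rightarrow> ennreal" where "F x = indicator D2 (restrict x L)" for x
  have Fm: "F \<in> borel_measurable (PiM (insert t L) (\<lambda>_. S))"
    unfolding F_def by (rule measurable_compose[OF measurable_restrict_subset borel_measurable_indicator[OF L(4)]]) auto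
  have L1: "\<forall>l\<in>L. t < l" using L(3) by auto
  have F1: "\<forall>x\<in>space (PiM (insert t L) (\<lambda>_. S)). F x \<le> 1" by (simp add: F_def indicator_def)
  from conditional_future[OF L(2) L1 Fm F1] obtain h where h: "h \<in> borel_measurable S" "\<forall>y\<in>space S. h y \<le> 1"
    "\<forall>J G. finite J \<longrightarrow> t \<in> J \<longrightarrow> (\<forall>j\<in>J. j \<le> t) \<longrightarrow> G \<in> borel_measurable (PiM J (\<lambda>_. S)) \<longrightarrow>
      (\<integral>\<^sup>+\<omega>. G (path J \<omega>) * F (path (insert t L) \<omega>) \<partial>M) = (\<integral>\<^sup>+\<omega>. G (path J \<omega>) * h (Y t \<omega>) \<partial>M)"
    by (elim bexE conjE)
  have p: "restrict (path I \<omega>) I' = path I' \<omega>" if "I' \<subseteq> I" for I I' \<omega>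
    using that by (simp add: path_def restrict_restrict Int_absorb1)
  have "emeasure M (A \<inter> B) = (\<integral>\<^sup>+\<omega>. indicator A \<omega> * (\<integral>\<^sup>+y. h y \<partial>P t (Y 0 \<omega>)) \<partial>M)"
    if A: "A \<in> cylinders {..0}" for A
  proof -
    obtain J1 D1 where J1: "A = path J1 -` D1 \<inter> space M" "finite J1" "J1 \<subseteq> {..0}" "D1 \<in> sets (PiM J1 (\<lambda>_. S))"
      using A by (rule cylindersE)
    define J where "J = insert 0 J1"
    define G :: "(real \<Rightarrow> 's) \<Rightarrow> ennreal" where "G x = indicator D1 (restrict x J1)" for x
    have Gm: "G \<in> borel_measurable (PiM (insert t J) (\<lambda>_. S))"
      unfolding G_def J_def by (rule measurable_compose[OF measurable_restrict_subset borel_measurable_indicator[OF J1(4)]]) auto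
    have AB: "A \<in> events" "B \<in> events" using A B cylinders_events by blast+
    have tJ: "t \<notin> J" using J1(3) t by (auto simp: J_def)
    have "emeasure M (A \<inter> B) = (\<integral>\<^sup>+\<omega>. indicator (A \<inter> B) \<omega> \<partial>M)" using AB by simp
    also have "\<dots> = (\<integral>\<^sup>+\<omega>. G (path (insert t J) \<omega>) * F (path (insert t L) \<omega>) \<partial>M)"
    proof (rule nn_integral_cong)
      fix \<omega> assume "\<omega> \<in> space M"
      moreover have "restrict (path (insert t J) \<omega>) J1 = path J1 \<omega>" by (rule p) (auto simp: J_def)
      moreover have "restrict (path (insert t L) \<omega>) L = path L \<omega>" by (rule p) auto
      ultimately show "indicator (A \<inter> B) \<omega> = G (path (insert t J) \<omega>) * F (path (insert t L) \<omega>)"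
        by (simp add: G_def F_def J1(1) L(1) indicator_def)
    qed
    also have "\<dots> = (\<integral>\<^sup>+\<omega>. G (path (insert t J) \<omega>) * h (Y t \<omega>) \<partial>M)"
      by (rule h(3)[rule_format, OF _ _ _ Gm]) (use J1 t in \<open>auto simp: J_def\<close>)
    also have "\<dots> = (\<integral>\<^sup>+\<omega>. (\<lambda>x. G x * h (x t)) (path (insert t J) \<omega>) \<partial>M)"
      by (simp add: path_def)
    also have "\<dots> = (\<integral>\<^sup>+\<omega>. \<integral>\<^sup>+y. (\<lambda>x. G x * h (x t)) ((path J \<omega>)(t := y)) \<partial>P (t - 0) (Y 0 \<omega>) \<partial>M)"
    proof (rule one_step[OF _ _ _ t])
      have "(\<lambda>x. h (x t)) \<in> borel_measurable (PiM (insert t J) (\<lambda>_. S))"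
        by (rule measurable_compose[OF _ h(1)], rule measurable_component_singleton) simp
      with Gm show "(\<lambda>x. G x * h (x t)) \<in> borel_measurable (PiM (insert t J) (\<lambda>_. S))"
        by (rule borel_measurable_times_ennreal)
    qed (use J1 in \<open>auto simp: J_def\<close>)
    also have "\<dots> = (\<integral>\<^sup>+\<omega>. indicator A \<omega> * (\<integral>\<^sup>+y. h y \<partial>P t (Y 0 \<omega>)) \<partial>M)"
    proof (rule nn_integral_cong)
      fix \<omega> assume \<omega>: "\<omega> \<in> space M"
      have t0: "0 \<le> t" using t by simp
      have "restrict ((path J \<omega>)(t := y)) J1 = path J1 \<omega>" for y
        using tJ by (auto simp: path_def J_def fun_eq_iff restrict_def)
      then have "G ((path J \<omega>)(t := y)) = indicator A \<omega>" for y
        using \<omega> by (simp add: G_def J1(1) indicator_def)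
      moreover have "h \<in> borel_measurable (P t (Y 0 \<omega>))"
        using h(1) by (simp add: measurable_cong_sets[OF sets_kernel[OF t0 space_Y[OF \<omega>]] refl])
      ultimately show "(\<integral>\<^sup>+y. (\<lambda>x. G x * h (x t)) ((path J \<omega>)(t := y)) \<partial>P (t - 0) (Y 0 \<omega>))
          = indicator A \<omega> * (\<integral>\<^sup>+y. h y \<partial>P t (Y 0 \<omega>))"
        by (simp add: nn_integral_cmult)
    qed
    finally show ?thesis .
  qed
  then show ?thesis using that h(1,2) by blast
qed

lemma distr_Y:
  assumes "sets \<mu> = sets S"
  shows "distr M S (Y t) = \<mu>"
proof -
  let ?\<Pi> = "PiM {..0::nat} (\<lambda>_. S)"
  have c: "(\<lambda>x. x 0) \<in> ?\<Pi> \<rightarrow>\<^sub>M S" by (rule measurable_component_singleton) simp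
  have "strict_mono_on {..0::nat} (\<lambda>_. t)" by (simp add: monotone_on_def)
  then have "distr M ?\<Pi> (\<lambda>\<omega>. \<lambda>i\<in>{..0}. Y t \<omega>) = markov_fdd S P \<mu> (\<lambda>_. t) 0"
    using fdd unfolding markov_process_with_fdd_def by blast
  also have "\<dots> = distr \<mu> ?\<Pi> (\<lambda>x. \<lambda>i\<in>{..0}. x)" by simp
  finally have "distr (distr M ?\<Pi> (\<lambda>\<omega>. \<lambda>i\<in>{..0}. Y t \<omega>)) S (\<lambda>x. x 0)
      = distr (distr \<mu> ?\<Pi> (\<lambda>x. \<lambda>i\<in>{..0}. x)) S (\<lambda>x. x 0)" by simp
  moreover have "(\<lambda>x. \<lambda>i\<in>{..0::nat}. x) \<in> \<mu> \<rightarrow>\<^sub>M ?\<Pi>"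
    unfolding measurable_cong_sets[OF assms refl] by measurable
  ultimately have "distr M S (Y t) = distr \<mu> S (\<lambda>x. x)"
    using c by (simp add: distr_distr comp_def)
  also have "\<dots> = \<mu>" using assms by (intro distr_id2) simp
  finally show ?thesis .
qed

end

section \<open>Exponential mixing\<close>

locale stationary_cbi_process = stationary_cbi b \<sigma> m v a P \<mu> + markov_process M Rplus P \<mu> Y
  for b \<sigma> m v a P \<mu> and M :: "'w measure" and Y
begin

lemma Y_nonneg: "\<omega> \<in> space M \<Longrightarrow> 0 \<le> Y t \<omega>"
  using space_Y[of \<omega> t] by (simp add: space_Rplus)

lemma expectation_absorption_le:
  assumes w: "0 \<le> w"
  shows "integrable M (\<lambda>\<omega>. 1 - exp (- w * Y 0 \<omega>))" "expectation (\<lambda>\<omega>. 1 - exp (- w * Y 0 \<omega>)) \<le> a * w / b"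
proof -
  have em: "(\<lambda>x. exp (- w * x)) \<in> borel_measurable Rplus" by (rule measurable_Rplus) simp
  have i: "integrable (distr M Rplus (Y 0)) (\<lambda>x. exp (- w * x))"
    unfolding distr_Y[OF sets_\<mu>] by (rule integrable_exp_\<mu>[OF w])
  then have i': "integrable M (\<lambda>\<omega>. exp (- w * Y 0 \<omega>))"
    by (rule integrable_distr[OF measurable_Y])
  then show "integrable M (\<lambda>\<omega>. 1 - exp (- w * Y 0 \<omega>))" by simp
  have "expectation (\<lambda>\<omega>. exp (- w * Y 0 \<omega>)) = (\<integral>x. exp (- w * x) \<partial>\<mu>)"
    using integral_distr[OF measurable_Y em, of 0] unfolding distr_Y[OF sets_\<mu>] by simp
  then show "expectation (\<lambda>\<omega>. 1 - exp (- w * Y 0 \<omega>)) \<le> a * w / b"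
    using laplace_\<mu>_ge[OF w] i' by (simp add: Bochner_Integration.integral_diff prob_space del: mult_minus_left)
qed

text \<open>Given the past, \<open>B\<close> has conditional probability \<open>g (Y 0)\<close>. The covariance does not change when the constant
  \<open>g 0\<close> is subtracted from \<open>g\<close>, and \<open>g (Y 0) - g 0\<close> is at most \<open>1 - exp (- w * Y 0)\<close> in absolute value.
  The factor \<open>2\<close> comes from estimating the two terms of the covariance separately.\<close>

lemma cylinder_covariance_le:
  assumes t: "0 < t" and w: "\<And>z. 0 \<le> z \<Longrightarrow> v t z \<le> w"
    and A: "A \<in> cylinders {..0}" and B: "B \<in> cylinders {t<..}"
  shows "\<bar>prob (A \<inter> B) - prob A * prob B\<bar> \<le> 2 * (a * w / b)"
proof -
  have t0: "0 \<le> t" using t by simp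
  have w0: "0 \<le> w" using w[of 0] v_nonneg[of 0 t] t by simp
  obtain h where h: "h \<in> borel_measurable Rplus" "\<And>y. y \<in> space Rplus \<Longrightarrow> h y \<le> (1 :: ennreal)"
    "\<And>A. A \<in> cylinders {..0} \<Longrightarrow>
      emeasure M (A \<inter> B) = (\<integral>\<^sup>+\<omega>. indicator A \<omega> * (\<integral>\<^sup>+y. h y \<partial>P t (Y 0 \<omega>)) \<partial>M)"
    by (rule past_future_kernel[OF t B]) blast
  define hr where "hr x = enn2real (h x)" for x
  have hr: "hr \<in> borel_measurable Rplus" unfolding hr_def using h(1) by measurable
  have hr0: "0 \<le> hr x" for x by (simp add: hr_def)
  have h_fin: "h x = ennreal (hr x)" if "0 \<le> x" for x
    using h(2)[of x] that unfolding hr_def space_Rplus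
    by (intro ennreal_enn2real[symmetric]) (auto intro: le_less_trans)
  have hr1: "hr x \<le> 1" if "0 \<le> x" for x
    using h(2)[of x] that h_fin[OF that] by (simp add: space_Rplus)
  define g where "g x = (\<integral>y. hr y \<partial>P t x)" for x
  have spP: "space (P t x) = {0..}" if "0 \<le> x" for x
    using sets_eq_imp_space_eq[OF sets_P[OF t0 that]] by (simp add: space_Rplus)
  have hg: "(\<integral>\<^sup>+y. h y \<partial>P t x) = ennreal (g x)" and g01: "0 \<le> g x" "g x \<le> 1" if x: "0 \<le> x" for x
  proof -
    interpret Px: prob_space "P t x" by (rule prob_space_P[OF t0 x])
    have hrm: "hr \<in> borel_measurable (P t x)"
      using hr by (simp add: measurable_cong_sets[OF sets_P[OF t0 x] refl])
    have i: "integrable (P t x) hr"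
      by (rule Px.integrable_const_bound[where B=1, OF AE_I2 hrm]) (simp add: spP[OF x] hr0 hr1)
    have "(\<integral>\<^sup>+y. h y \<partial>P t x) = (\<integral>\<^sup>+y. ennreal (hr y) \<partial>P t x)"
      by (rule nn_integral_cong) (simp add: spP[OF x] h_fin)
    also have "\<dots> = ennreal (g x)"
      unfolding g_def by (rule nn_integral_eq_integral[OF i]) (simp add: hr0)
    finally show "(\<integral>\<^sup>+y. h y \<partial>P t x) = ennreal (g x)" .
    show "0 \<le> g x" unfolding g_def by (simp add: hr0)
    have "g x \<le> (\<integral>y. 1 \<partial>P t x)"
      unfolding g_def by (rule integral_mono[OF i]) (simp_all add: spP[OF x] hr1)
    then show "g x \<le> 1" by (simp add: Px.prob_space)
  qed
  have g_close: "\<bar>g x - g 0\<bar> \<le> 1 - exp (- w * x)" if "0 \<le> x" for x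
    using transition_operator_close[OF t0 that w hr hr0 hr1] by (simp add: g_def mult.commute)
  have gm: "g \<in> borel_measurable Rplus"
  proof -
    have "(\<lambda>x. \<integral>\<^sup>+y. h y \<partial>P t x) \<in> borel_measurable Rplus"
      by (rule measurable_compose[OF measurable_prob_algebraD[OF kernel[OF t0]] nn_integral_measurable_subprob_algebra[OF h(1)]])
    then have "(\<lambda>x. enn2real (\<integral>\<^sup>+y. h y \<partial>P t x)) \<in> borel_measurable Rplus" by measurable
    also have "?this \<longleftrightarrow> ?thesis"
      by (rule measurable_cong) (simp add: space_Rplus hg g01)
    finally show ?thesis .
  qed
  have gY: "(\<lambda>\<omega>. g (Y 0 \<omega>)) \<in> borel_measurable M" by (rule measurable_compose[OF measurable_Y gm])
  have formula: "prob (C \<inter> B) = expectation (\<lambda>\<omega>. indicator C \<omega> * g (Y 0 \<omega>))" if C: "C \<in> cylinders {..0}" for C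
  proof -
    have Ce: "C \<in> events" using C cylinders_events by auto
    have i: "integrable M (\<lambda>\<omega>. indicator C \<omega> * g (Y 0 \<omega>))"
    proof (rule integrable_const_bound[where B=1])
      show "AE \<omega> in M. norm (indicator C \<omega> * g (Y 0 \<omega>)) \<le> 1"
        using g01 Y_nonneg by (intro AE_I2) (simp add: indicator_def)
    qed (use gY Ce in measurable)
    have "emeasure M (C \<inter> B) = (\<integral>\<^sup>+\<omega>. ennreal (indicator C \<omega> * g (Y 0 \<omega>)) \<partial>M)"
      unfolding h(3)[OF C] by (rule nn_integral_cong) (simp add: hg Y_nonneg indicator_def)
    also have "\<dots> = ennreal (expectation (\<lambda>\<omega>. indicator C \<omega> * g (Y 0 \<omega>)))"
      by (rule nn_integral_eq_integral[OF i]) (intro AE_I2, simp add: g01 Y_nonneg)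
    finally have "ennreal (prob (C \<inter> B)) = \<dots>" by (simp add: emeasure_eq_measure)
    moreover have "0 \<le> expectation (\<lambda>\<omega>. indicator C \<omega> * g (Y 0 \<omega>))"
      by (intro Bochner_Integration.integral_nonneg) (simp add: g01 Y_nonneg)
    ultimately show ?thesis by simp
  qed
  define D where "D \<omega> = g (Y 0 \<omega>) - g 0" for \<omega>
  define q where "q \<omega> = 1 - exp (- w * Y 0 \<omega>)" for \<omega>
  have qi: "integrable M q" and qb: "expectation q \<le> a * w / b"
    unfolding q_def[abs_def] by (rule expectation_absorption_le[OF w0])+
  have Dq: "\<bar>D \<omega>\<bar> \<le> q \<omega>" if "\<omega> \<in> space M" for \<omega>
    using g_close[OF Y_nonneg[OF that]] by (simp add: D_def q_def)
  have Dm: "D \<in> borel_measurable M" unfolding D_def[abs_def] using gY by measurable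
  have bound: "\<bar>expectation (\<lambda>\<omega>. indicator C \<omega> * D \<omega>)\<bar> \<le> expectation q"
    "integrable M (\<lambda>\<omega>. indicator C \<omega> * D \<omega>)" if C: "C \<in> events" for C
  proof -
    have m: "(\<lambda>\<omega>. indicator C \<omega> * D \<omega>) \<in> borel_measurable M" using C Dm by measurable
    have le: "norm (indicator C \<omega> * D \<omega>) \<le> q \<omega>" if "\<omega> \<in> space M" for \<omega>
      using Dq[OF that] by (auto simp: indicator_def)
    have i: "integrable M (\<lambda>\<omega>. indicator C \<omega> * D \<omega>)"
    proof (rule Bochner_Integration.integrable_bound[OF qi m])
      show "AE \<omega> in M. norm (indicator C \<omega> * D \<omega>) \<le> norm (q \<omega>)"
        using le by (intro AE_I2) (simp add: order_trans[OF _ abs_ge_self])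
    qed
    have "\<bar>expectation (\<lambda>\<omega>. indicator C \<omega> * D \<omega>)\<bar> \<le> expectation (\<lambda>\<omega>. \<bar>indicator C \<omega> * D \<omega>\<bar>)"
      by (rule integral_abs_bound)
    also have "\<dots> \<le> expectation q"
      using i qi le by (intro integral_mono) auto
    finally show "\<bar>expectation (\<lambda>\<omega>. indicator C \<omega> * D \<omega>)\<bar> \<le> expectation q" .
    show "integrable M (\<lambda>\<omega>. indicator C \<omega> * D \<omega>)" by (rule i)
  qed
  have split: "expectation (\<lambda>\<omega>. indicator C \<omega> * g (Y 0 \<omega>))
      = expectation (\<lambda>\<omega>. indicator C \<omega> * D \<omega>) + prob C * g 0" if C: "C \<in> events" for C
  proof -
    have "expectation (\<lambda>\<omega>. indicator C \<omega> * g (Y 0 \<omega>))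
        = expectation (\<lambda>\<omega>. indicator C \<omega> * D \<omega> + indicator C \<omega> * g 0)"
      by (simp add: D_def algebra_simps)
    also have "\<dots> = expectation (\<lambda>\<omega>. indicator C \<omega> * D \<omega>) + expectation (\<lambda>\<omega>. indicator C \<omega> * g 0)"
      using C by (intro Bochner_Integration.integral_add bound integrable_mult_left integrable_real_indicator)
        (auto simp: emeasure_eq_measure)
    finally show ?thesis using C by simp
  qed
  interpret alg: algebra "space M" "cylinders {..0}" by (rule algebra_cylinders)
  have Ae: "A \<in> events" and Be: "B \<in> events" using A B cylinders_events by auto
  have pA: "prob (A \<inter> B) = expectation (\<lambda>\<omega>. indicator A \<omega> * D \<omega>) + prob A * g 0"
    using formula[OF A] split[OF Ae] by simp
  have "space M \<inter> B = B" using sets.sets_into_space[OF Be] by auto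
  then have pB: "prob B = expectation (\<lambda>\<omega>. indicator (space M) \<omega> * D \<omega>) + g 0"
    using formula[OF alg.top] split[of "space M"] by (simp add: prob_space)
  have "prob (A \<inter> B) - prob A * prob B
      = expectation (\<lambda>\<omega>. indicator A \<omega> * D \<omega>) - prob A * expectation (\<lambda>\<omega>. indicator (space M) \<omega> * D \<omega>)"
    unfolding pA pB by (simp add: algebra_simps)
  also have "\<bar>\<dots>\<bar> \<le> \<bar>expectation (\<lambda>\<omega>. indicator A \<omega> * D \<omega>)\<bar>
      + prob A * \<bar>expectation (\<lambda>\<omega>. indicator (space M) \<omega> * D \<omega>)\<bar>"
    by (rule order_trans[OF abs_triangle_ineq4]) (simp add: abs_mult)
  also have "\<dots> \<le> expectation q + 1 * expectation q"
    using Ae by (intro add_mono mult_mono bound) auto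
  also have "\<dots> \<le> 2 * (a * w / b)" using qb by simp
  finally show ?thesis .
qed

lemma mixing_coefficient_le:
  assumes "\<And>A B. A \<in> cylinders {..0} \<Longrightarrow> B \<in> cylinders {t<..} \<Longrightarrow> \<bar>prob (A \<inter> B) - prob A * prob B\<bar> \<le> K"
  shows "mixing_coefficient M Rplus Y t \<le> K"
proof -
  have step1: "\<bar>prob (A \<inter> B) - prob A * prob B\<bar> \<le> K"
    if "A \<in> cylinders {..0}" "B \<in> sigma_sets (space M) (cylinders {t<..})" for A B
  proof (rule covariance_bound_extends[OF algebra_cylinders cylinders_events _ that(2)])
    show "A \<in> events" using that(1) cylinders_events by blast
  qed (rule assms[OF that(1)])
  have step2: "\<bar>prob (A \<inter> B) - prob A * prob B\<bar> \<le> K"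
    if A: "A \<in> sigma_sets (space M) (cylinders {..0})" and B: "B \<in> sigma_sets (space M) (cylinders {t<..})" for A B
  proof -
    have "\<bar>prob (B \<inter> A) - prob B * prob A\<bar> \<le> K"
    proof (rule covariance_bound_extends[OF algebra_cylinders cylinders_events _ A])
      show "B \<in> events" using B sets.sigma_sets_subset[OF cylinders_events] by blast
      show "\<bar>prob (B \<inter> A) - prob B * prob A\<bar> \<le> K" if "A \<in> cylinders {..0}" for A
        using step1[OF that B] by (simp add: Int_commute mult.commute)
    qed
    then show ?thesis by (simp add: Int_commute mult.commute)
  qed
  have ne: "generated_events M Rplus Y I \<noteq> {}" for I
    unfolding generated_events_def using sigma_sets.Empty by blast
  show ?thesis
    unfolding mixing_coefficient_def
  proof (intro cSUP_least ne)
    fix A B assume "A \<in> generated_events M Rplus Y {..0}" "B \<in> generated_events M Rplus Y {t<..}"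
    then show "\<bar>prob (A \<inter> B) - prob A * prob B\<bar> \<le> K"
      using generated_events_subset by (intro step2) blast+
  qed
qed

lemma mixing_coefficient_le_1: "mixing_coefficient M Rplus Y t \<le> 1"
proof (rule mixing_coefficient_le)
  fix A B
  have "0 \<le> prob A * prob B" "prob A * prob B \<le> 1" by (auto intro: mult_le_one)
  then show "\<bar>prob (A \<inter> B) - prob A * prob B\<bar> \<le> 1"
    using prob_le_1[of "A \<inter> B"] measure_nonneg[of M "A \<inter> B"] by linarith
qed

text \<open>After the time \<open>T\<close> at which the flow from any starting point has come below \<open>\<theta>\<close>, the covariance bound
  applies with \<open>w = \<theta> exp (- b (t - T))\<close>; before \<open>T\<close> the trivial bound \<open>1\<close> is absorbed in the factor \<open>e\<^sup>b\<^sup>T\<close>.\<close>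

theorem exponentially_mixing:
  assumes \<theta>: "0 < \<theta>" and grey: "(\<integral>\<^sup>+z\<in>{\<theta><..}. ennreal (1 / \<phi> z) \<partial>lborel) < \<infinity>"
  shows "\<exists>C>0. \<exists>c>0. \<forall>t\<ge>0. mixing_coefficient M Rplus Y t \<le> C * exp (- c * t)"
proof -
  obtain T where T: "0 \<le> T" "\<And>t z. T \<le> t \<Longrightarrow> 0 \<le> z \<Longrightarrow> v t z \<le> \<theta>"
    using v_descends_below[OF \<theta> grey] by blast
  define C where "C = exp (b * T) * (1 + 2 * (a * \<theta> / b))"
  have aq: "0 \<le> a * \<theta> / b" using a_nonneg b_pos \<theta> by simp
  have eq: "C * exp (- b * t) = exp (- b * (t - T)) * (1 + 2 * (a * \<theta> / b))" for t
  proof -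
    have "exp (- b * (t - T)) = exp (b * T) * exp (- b * t)"
      by (simp add: exp_add[symmetric] algebra_simps)
    then show ?thesis by (simp add: C_def)
  qed
  have "mixing_coefficient M Rplus Y t \<le> C * exp (- b * t)" if t: "0 \<le> t" for t
  proof (cases "T < t")
    case True
    have w: "v t z \<le> exp (- b * (t - T)) * \<theta>" if "0 \<le> z" for z
    proof -
      have "v (T + (t - T)) z \<le> exp (- b * (t - T)) * v T z"
        using True that T(1) by (intro v_decay) auto
      also have "\<dots> \<le> exp (- b * (t - T)) * \<theta>" using T(2)[OF order_refl that] by simp
      finally show ?thesis by simp
    qed
    have "mixing_coefficient M Rplus Y t \<le> 2 * (a * (exp (- b * (t - T)) * \<theta>) / b)"
      using True T(1) w by (intro mixing_coefficient_le cylinder_covariance_le) auto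
    also have "\<dots> = exp (- b * (t - T)) * (2 * (a * \<theta> / b))" by (simp add: field_simps)
    also have "\<dots> \<le> C * exp (- b * t)" unfolding eq by (intro mult_left_mono) auto
    finally show ?thesis .
  next
    case False
    then have "1 * 1 \<le> exp (- b * (t - T)) * (1 + 2 * (a * \<theta> / b))"
      using aq b_pos by (intro mult_mono) (auto simp: mult_le_0_iff)
    then show ?thesis using mixing_coefficient_le_1[of t] unfolding eq by simp
  qed
  moreover have "0 < C" using aq by (simp add: C_def add_pos_nonneg)
  ultimately show ?thesis using b_pos by blast
qed

end

theorem theorem2p7:
  fixes a b \<sigma> \<theta> :: real
    and m \<mu> :: "real measure"
    and \<phi> :: "real \<Rightarrow> real"
    and v :: "real \<Rightarrow> real \<Rightarrow> real"
    and P :: "real \<Rightarrow> real \<Rightarrow> real measure"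
    and M :: "'w measure"
    and Y :: "real \<Rightarrow> 'w \<Rightarrow> real"
  assumes "\<sigma> \<ge> 0" and "a \<ge> 0"
    and "admissible_jump_measure m"
    and "\<phi> = branching_mechanism b \<sigma> m"
    and "cumulant_flow \<phi> v"
    and "cbi_semigroup v a P"
    and "b > 0"
    and "stationary_distribution Rplus P \<mu>"
    and "\<theta> > 0"
    and "\<And>z. z > \<theta> \<Longrightarrow> \<phi> z > 0"
    and "(\<integral>\<^sup>+z\<in>{\<theta><..}. ennreal (1 / \<phi> z) \<partial>lborel) < \<infinity>"
    and "prob_space M"
    and "markov_process_with_fdd M Rplus P \<mu> Y"
  shows "\<exists>C>0. \<exists>c>0. \<forall>t\<ge>0. mixing_coefficient M Rplus Y t \<le> C * exp (- c * t)"
proof -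
  interpret M: prob_space M by fact
  interpret stationary_cbi_process b \<sigma> m v a P \<mu> M Y
  proof unfold_locales
    show "P t \<in> Rplus \<rightarrow>\<^sub>M prob_algebra Rplus" if "0 \<le> t" for t
      using \<open>cbi_semigroup v a P\<close> that by (simp add: cbi_semigroup_def transition_semigroup_def)
  qed (use assms in simp_all)
  show ?thesis
    by (rule exponentially_mixing[OF \<open>\<theta> > 0\<close>]) (use assms in simp)
qed

end
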